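(* For every $n\in\mathbb N$ let $\mathcal D_n=(\phi_\omega^n:\omega\in\Omega_n)$ be a frame of $\mathbb R^{I_n}$ with normalized elements and analysis operator $\boldsymbol\Phi_n$. Let $(\mathcal J_n)_{n\in\mathbb N}$ be a family of functionals $\mathcal J_n:\mathbb R^{\Omega_n}\to\mathbb R\cup\{\infty\}$ having the property that $$\mathcal J_n(x_n)\le\mathcal J_n(\bar x_n)\quad\text{whenever}\quad|x_n(\omega)|\le|\bar x_n(\omega)|\ \text{ for all }\omega\in\Omega_n.$$ Consider the data model $Y_n=x_n+\boldsymbol\Phi_n\epsilon_n$, where $(\epsilon_n)_{n\in\mathbb N}$ is a sequence of random vectors in $\mathbb R^{I_n}$ with independent $N(0,\sigma^2)$-distributed entries, let $(\alpha_n)_{n\in\mathbb N}$ be a sequence in $(0,1)$ converging to some $\alpha\in[0,1)$, and let $\hat x_n:=\mathbf S(Y_n,T(\alpha_n,|\Omega_n|))$ be the soft-thresholding estimate with the extreme value threshold $$T(\alpha_n,|\Omega_n|):=\sigma\sqrt{2\log|\Omega_n|}+\sigma\,\frac{2z(\alpha_n)-\log\log|\Omega_n|-\log\pi}{2\sqrt{2\log|\Omega_n|}},\qquad z(\alpha_n):=-\log\log\big(1/(1-\alpha_n)\big).$$ Then $$\liminf_{n\to\infty}\mathbf P\{\mathcal J_n(\hat x_n)\le\mathcal J_n(x_n)\,;\ \forall x_n\in\operatorname{Ran}(\boldsymbol\Phi_n)\}\ge1-\alpha.$$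
   Context: Fix $d\in\mathbb N$ and $\sigma>0$; $I_n=\{0,\dots,n-1\}^d$, and $\mathbb R^{I_n}$ carries the Euclidean inner product and norm. A frame of $\mathbb R^{I_n}$ is a finite family spanning $\mathbb R^{I_n}$; normalized means $\|\phi_\omega^n\|=1$ for all $\omega\in\Omega_n$. The analysis operator $\boldsymbol\Phi_n:\mathbb R^{I_n}\to\mathbb R^{\Omega_n}$ is $(\boldsymbol\Phi_nu)(\omega)=\langle\phi_\omega^n,u\rangle$. Soft-thresholding acts componentwise: $\mathbf S(Y,T)(\omega)=\operatorname{sign}(Y(\omega))\,(|Y(\omega)|-T)_+$. The notation $\mathbf P\{A(x_n);\forall x_n\in S\}$ means the probability of the intersection of the events $A(x_n)$ over all $x_n\in S$, the noise $\epsilon_n$ being the same for all $x_n$. *)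

theory Defs
  imports "HOL-Probability.Probability"
begin

definition grid :: "nat \<Rightarrow> nat \<Rightarrow> (nat \<Rightarrow> nat) set" where
  "grid d n = ({..<d} \<rightarrow>\<^sub>E {..<n})"

text \<open>The space of real vectors indexed by a set \<open>A\<close>, as functions that are undefined
  off \<open>A\<close>. It is the underlying space of the product measure space of copies of borel
  over \<open>A\<close>.\<close>

definition vecs :: "'a set \<Rightarrow> ('a \<Rightarrow> real) set" where
  "vecs A = (A \<rightarrow>\<^sub>E UNIV)"

definition inner_on :: "'a set \<Rightarrow> ('a \<Rightarrow> real) \<Rightarrow> ('a \<Rightarrow> real) \<Rightarrow> real" where
  "inner_on A u v = (\<Sum>i\<in>A. u i * v i)"

definition is_frame :: "'a set \<Rightarrow> 'b set \<Rightarrow> ('b \<Rightarrow> 'a \<Rightarrow> real) \<Rightarrow> bool" where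
  "is_frame A \<Omega> \<phi> \<longleftrightarrow>
     finite \<Omega> \<and> (\<forall>\<omega>\<in>\<Omega>. \<phi> \<omega> \<in> vecs A) \<and>
     (\<forall>u\<in>vecs A. \<exists>c :: 'b \<Rightarrow> real. \<forall>i\<in>A. u i = (\<Sum>\<omega>\<in>\<Omega>. c \<omega> * \<phi> \<omega> i))"

definition normalized :: "'a set \<Rightarrow> 'b set \<Rightarrow> ('b \<Rightarrow> 'a \<Rightarrow> real) \<Rightarrow> bool" where
  "normalized A \<Omega> \<phi> \<longleftrightarrow> (\<forall>\<omega>\<in>\<Omega>. L2_set (\<phi> \<omega>) A = 1)"

definition analysis_op ::
  "'a set \<Rightarrow> 'b set \<Rightarrow> ('b \<Rightarrow> 'a \<Rightarrow> real) \<Rightarrow> ('a \<Rightarrow> real) \<Rightarrow> 'b \<Rightarrow> real" where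
  "analysis_op A \<Omega> \<phi> u = (\<lambda>\<omega>\<in>\<Omega>. inner_on A (\<phi> \<omega>) u)"

definition soft_threshold :: "'b set \<Rightarrow> ('b \<Rightarrow> real) \<Rightarrow> real \<Rightarrow> 'b \<Rightarrow> real" where
  "soft_threshold \<Omega> Y T = (\<lambda>\<omega>\<in>\<Omega>. sgn (Y \<omega>) * max 0 (\<bar>Y \<omega>\<bar> - T))"

definition ev_quantile :: "real \<Rightarrow> real" where
  "ev_quantile a = - ln (ln (1 / (1 - a)))"

text \<open>For \<open>N \<le> 1\<close> the formula is meaningless and the value below is a junk value; a frame
  indexed by the grid with \<open>d \<ge> 1\<close> has at least \<open>n ^ d\<close> elements, so this concerns at most
  \<open>n \<le> 1\<close> and does not influence limits as \<open>n\<close> tends to infinity.\<close>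

definition ev_threshold :: "real \<Rightarrow> real \<Rightarrow> nat \<Rightarrow> real" where
  "ev_threshold \<sigma> a N =
     \<sigma> * sqrt (2 * ln (real N)) +
     \<sigma> * ((2 * ev_quantile a - ln (ln (real N)) - ln pi) / (2 * sqrt (2 * ln (real N))))"

text \<open>The functionals in the theorem are not assumed measurable and the event is an uncountable
  intersection, so it need not belong to the sigma-algebra, and \<^const>\<open>measure\<close> would then return
  the junk value 0. Its probability is therefore read as inner probability; on measurable events this is the ordinary
  probability.\<close>

definition inner_prob :: "'w measure \<Rightarrow> 'w set \<Rightarrow> real" where
  "inner_prob M E = (SUP B\<in>{B \<in> sets M. B \<subseteq> E}. measure M B)"

lemma inner_prob_measurable:
  assumes "prob_space M" and "E \<in> sets M"
  shows "inner_prob M E = measure M E"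
proof -
  interpret prob_space M by fact
  show ?thesis
    unfolding inner_prob_def
    by (rule cSup_eq_maximum) (use assms(2) in \<open>auto intro: finite_measure_mono\<close>)
qed

end

theory Submission
  imports Defs "HOL-Real_Asymp.Real_Asymp"
begin

text \<open>If every noise coefficient \<open>\<langle>\<phi>\<^sub>\<omega>, \<epsilon>\<rangle>\<close> is at most \<open>T\<close> in absolute value, soft-thresholding at \<open>T\<close>
  shrinks every coefficient of every signal below its true size, so the monotone functional cannot increase. The
  coefficients are correlated Gaussians, and a union bound would only give \<open>1 - log (1 / (1 - \<alpha>))\<close>. Sidak's
  inequality bounds the probability from below by the value \<open>p ^ N\<close> for independent coefficients, where \<open>p\<close> is
  the mass of \<open>[-T, T]\<close> and \<open>N = |\<Omega>|\<close>. The Gaussian tail bound makes \<open>N * (1 - p)\<close> asymptotically at most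
  \<open>log (1 / (1 - \<alpha>))\<close>, so the lower bound is \<open>1 - \<alpha>\<close> in the limit; \<open>N\<close> tends to infinity because a frame has at
  least as many elements as the dimension. Since the threshold decreases in \<open>\<alpha>\<close>, a fixed level slightly above the
  limit can replace \<open>\<alpha>\<^sub>n\<close>.

  Sidak's inequality follows by inserting the slabs one at a time: for a symmetric convex set \<open>K\<close>, the conditional
  probability of \<open>K\<close> given \<open>\<langle>v, x\<rangle> = t\<close> is even and log-concave in \<open>t\<close> (Prekopa-Leindler), hence decreasing
  in \<open>|t|\<close>, so it correlates positively with the event \<open>|\<langle>v, x\<rangle>| \<le> T\<close>.\<close>

subsection \<open>The Prekopa-Leindler inequality\<close>

lemma emeasure_lborel_convex_le:
  fixes C :: "real set"
  assumes "convex C" and b: "\<And>a b. a \<in> C \<Longrightarrow> b \<in> C \<Longrightarrow> a \<le> b \<Longrightarrow> ennreal (b - a) \<le> L"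
  shows "emeasure lborel C \<le> L"
proof -
  \<comment> \<open>Truncation makes the infimum and supremum exist; the windows exhaust the line,
    so continuity from below removes it at the end.\<close>
  have *: "emeasure lborel (C \<inter> {- real m..real m}) \<le> L" for m
  proof (cases "C \<inter> {- real m..real m} = {}")
    case False
    let ?D = "C \<inter> {- real m..real m}"
    define p q where "p = Inf ?D" and "q = Sup ?D"
    have bdd: "bdd_below ?D" "bdd_above ?D" by auto
    have "p \<le> x \<and> x \<le> q" if "x \<in> ?D" for x
      unfolding p_def q_def using cInf_lower[OF that bdd(1)] cSup_upper[OF that bdd(2)] by (rule conjI)
    then have "?D \<subseteq> {p..q}" unfolding atLeastAtMost_def atLeast_def atMost_def by blast
    then have "emeasure lborel ?D \<le> emeasure lborel {p..q}" by (intro emeasure_mono) auto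
    also have "\<dots> \<le> ennreal (q - p)"
      by (cases "p \<le> q") auto
    also have "\<dots> \<le> L"
    proof (rule ennreal_le_epsilon)
      fix e :: real assume e: "0 < e"
      obtain x where x: "x \<in> ?D" "x < p + e/2"
        using cInf_lessD[OF False, of "p + e/2"] e by (auto simp: p_def)
      obtain y where y: "y \<in> ?D" "q - e/2 < y"
        using less_cSupD[OF False, of "q - e/2"] e by (auto simp: q_def)
      have "ennreal (q - p) \<le> ennreal ((y - x) + e)"
        using x y by (intro ennreal_leI) auto
      also have "\<dots> \<le> ennreal (max 0 (y - x) + e)" using e by (intro ennreal_leI) auto
      also have "\<dots> = ennreal (max 0 (y - x)) + ennreal e"
        using e by (intro ennreal_plus) auto
      also have "ennreal (max 0 (y - x)) \<le> L"
        using b[of x y] x y by (cases "x \<le> y") (auto simp: max_def)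
      finally show "ennreal (q - p) \<le> L + ennreal e" by (simp add: add_mono)
    qed
    finally show ?thesis .
  qed simp
  have "C \<in> sets lborel"
    using assms(1) by (simp add: is_interval_convex_1[symmetric] real_interval_borel_measurable)
  then have "(SUP m. emeasure lborel (C \<inter> {- real m..real m})) = emeasure lborel (\<Union>m. C \<inter> {- real m..real m})"
    by (intro SUP_emeasure_incseq) (auto simp: incseq_def)
  also have "(\<Union>m. C \<inter> {- real m..real m}) = C"
  proof -
    have "\<exists>m. - real m \<le> x \<and> x \<le> real m" for x
    proof -
      obtain m where "\<bar>x\<bar> \<le> real m" using real_arch_simple by blast
      then have "- real m \<le> x \<and> x \<le> real m" by linarith
      then show ?thesis ..
    qed
    then show ?thesis by auto
  qed
  finally have eq: "(SUP m. emeasure lborel (C \<inter> {- real m..real m})) = emeasure lborel C" .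
  show ?thesis unfolding eq[symmetric] by (rule SUP_least) (rule *)
qed

text \<open>Combining the segments [c, c'] in \<open>C\<close> and [d, d'] in \<open>D\<close> fills
  the segment between the combined endpoints, whose length is the weighted sum of the two lengths.
  Since an interval is as long as the supremum of the distances in it, taking suprema over
  \<open>C\<close> and then over \<open>D\<close> finishes.\<close>

lemma brunn_minkowski_intervals:
  fixes C D E :: "real set"
  assumes C: "convex C" "C \<noteq> {}" and D: "convex D" "D \<noteq> {}" and E: "E \<in> sets lborel"
    and u: "0 < u" "u < 1"
    and sub: "\<And>x y. x \<in> C \<Longrightarrow> y \<in> D \<Longrightarrow> (1 - u) * x + u * y \<in> E"
  shows "ennreal (1 - u) * emeasure lborel C + ennreal u * emeasure lborel D \<le> emeasure lborel E"
proof -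
  have 1: "ennreal ((1 - u) * (c' - c) + u * (d' - d)) \<le> emeasure lborel E"
    if "c \<in> C" "c' \<in> C" "c \<le> c'" "d \<in> D" "d' \<in> D" "d \<le> d'" for c c' d d'
  proof -
    let ?p = "(1 - u) * c + u * d" and ?q = "(1 - u) * c' + u * d'"
    have pq: "?p \<le> ?q" using that u by (intro add_mono mult_left_mono) auto
    have "{?p..?q} \<subseteq> E"
    proof
      fix z assume z: "z \<in> {?p..?q}"
      \<comment> \<open>\<open>r\<close> is the relative position of \<open>z\<close> in the
        segment; the points at the same fraction of [c, c'] and of [d, d'] combine to
        \<open>z\<close>. The value 0 in the degenerate case is harmless, as then \<open>z\<close>
        is \<open>?p\<close>.\<close>
      define r where "r = (if ?p = ?q then 0 else (z - ?p) / (?q - ?p))"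
      have r: "0 \<le> r" "r \<le> 1" using z pq by (auto simp: r_def field_simps)
      have zr: "z = ?p + r * (?q - ?p)" using z by (auto simp: r_def)
      have "c + r * (c' - c) \<in> C"
        using convexD_alt[OF C(1) that(1,2) r] by (simp add: algebra_simps)
      moreover have "d + r * (d' - d) \<in> D"
        using convexD_alt[OF D(1) that(4,5) r] by (simp add: algebra_simps)
      ultimately have "(1 - u) * (c + r * (c' - c)) + u * (d + r * (d' - d)) \<in> E" by (rule sub)
      also have "(1 - u) * (c + r * (c' - c)) + u * (d + r * (d' - d)) = z"
        unfolding zr by (simp add: algebra_simps)
      finally show "z \<in> E" .
    qed
    then have "emeasure lborel {?p..?q} \<le> emeasure lborel E" using E by (intro emeasure_mono)
    then show ?thesis using pq by (simp add: algebra_simps)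
  qed
  show ?thesis
  proof (cases "emeasure lborel E = \<top>")
    case False
    then obtain e where e: "emeasure lborel E = ennreal e" "0 \<le> e"
      by (metis ennreal_cases)
    have 2: "(1 - u) * (c' - c) + u * (d' - d) \<le> e"
      if "c \<in> C" "c' \<in> C" "c \<le> c'" "d \<in> D" "d' \<in> D" "d \<le> d'" for c c' d d'
      using 1[OF that] e by simp
    have 3: "ennreal (1 - u) * emeasure lborel C \<le> ennreal (e - u * (d' - d))"
      if "d \<in> D" "d' \<in> D" "d \<le> d'" for d d'
    proof -
      have "emeasure lborel C \<le> ennreal ((e - u * (d' - d)) / (1 - u))"
        using 2[OF _ _ _ that] u
        by (intro emeasure_lborel_convex_le C ennreal_leI) (simp add: field_simps)
      then have "ennreal (1 - u) * emeasure lborel C \<le> ennreal (1 - u) * ennreal ((e - u * (d' - d)) / (1 - u))"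
        by (rule mult_left_mono) simp
      also have "\<dots> = ennreal (e - u * (d' - d))" using u by (simp add: ennreal_mult'[symmetric])
      finally show ?thesis .
    qed
    obtain d0 where "d0 \<in> D" using D by auto
    from 3[OF this this] have "ennreal (1 - u) * emeasure lborel C < \<top>"
      by (simp add: le_less_trans)
    then obtain k where k: "ennreal (1 - u) * emeasure lborel C = ennreal k" "0 \<le> k"
      by (metis ennreal_cases order_less_irrefl)
    \<comment> \<open>Going back from \<open>ennreal\<close> to reals needs a nonnegative right-hand
      side, because negative reals are mapped to 0; the degenerate segment c = c' provides
      it.\<close>
    have 4: "k \<le> e - u * (d' - d)" if "d \<in> D" "d' \<in> D" "d \<le> d'" for d d'
    proof -
      obtain c where "c \<in> C" using C by auto
      then have "0 \<le> e - u * (d' - d)" using 2[of c c d d'] that by simp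
      then show ?thesis using 3[OF that] k by simp
    qed
    have "emeasure lborel D \<le> ennreal ((e - k) / u)"
      using 4 u by (intro emeasure_lborel_convex_le D ennreal_leI) (simp add: field_simps)
    then have "ennreal u * emeasure lborel D \<le> ennreal u * ennreal ((e - k) / u)"
      by (rule mult_left_mono) simp
    also have "\<dots> = ennreal (e - k)" using u by (simp add: ennreal_mult'[symmetric])
    finally have "ennreal (1 - u) * emeasure lborel C + ennreal u * emeasure lborel D \<le> ennreal k + ennreal (e - k)"
      by (simp add: k)
    also have "\<dots> = ennreal e" using 4[OF \<open>d0 \<in> D\<close> \<open>d0 \<in> D\<close>] k by (subst ennreal_plus[symmetric]) auto
    finally show ?thesis by (simp add: e)
  qed simp
qed

section \<open>Layer-cake formula and the Prekopa-Leindler inequality on the line\<close>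

lemma nn_integral_layer_cake_bounded:
  fixes f :: "'a \<Rightarrow> ennreal"
  assumes "sigma_finite_measure M" and [measurable]: "f \<in> borel_measurable M"
    and A: "0 < A" and le: "\<And>x. x \<in> space M \<Longrightarrow> f x \<le> ennreal A"
  shows "(\<integral>\<^sup>+x. f x \<partial>M) = ennreal A * (\<integral>\<^sup>+r\<in>{0..<1}. emeasure M {x \<in> space M. ennreal (A * r) < f x} \<partial>lborel)"
proof -
  interpret M: sigma_finite_measure M by fact
  interpret pair_sigma_finite M "lborel :: real measure" ..
  let ?I = "\<lambda>x r. indicator {0..<1} r * indicator {y \<in> space M. ennreal (A * r) < f y} x :: ennreal"
  \<comment> \<open>Levels are measured as fractions \<open>r\<close> of the bound \<open>A\<close>,
    so that functions with different suprema can later be compared at the same \<open>r\<close>.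
    Tonelli then exchanges \<open>x\<close> and \<open>r\<close>.\<close>
  have *: "f x = ennreal A * (\<integral>\<^sup>+r. ?I x r \<partial>lborel)" if x: "x \<in> space M" for x
  proof -
    from le[OF x] obtain b where b: "f x = ennreal b" "0 \<le> b" "b \<le> A"
      using A by (metis ennreal_cases ennreal_le_iff less_imp_le neq_top_trans ennreal_neq_top)
    have "r < 1" if "A * r < b" for r
      using that b A by (metis less_le_trans mult.right_neutral mult_less_cancel_left_pos)
    then have "?I x r = indicator {0..<b / A} r" for r
      using b A x by (auto simp: indicator_def ennreal_less_iff field_simps)
    then have "(\<integral>\<^sup>+r. ?I x r \<partial>lborel) = emeasure lborel {0..<b / A}" by simp
    also have "\<dots> = ennreal (b / A)" using b A by simp
    finally show ?thesis using b A by (simp add: ennreal_mult'[symmetric])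
  qed
  have "(\<integral>\<^sup>+x. f x \<partial>M) = (\<integral>\<^sup>+x. ennreal A * (\<integral>\<^sup>+r. ?I x r \<partial>lborel) \<partial>M)"
    using * by (intro nn_integral_cong)
  also have "\<dots> = ennreal A * (\<integral>\<^sup>+x. (\<integral>\<^sup>+r. ?I x r \<partial>lborel) \<partial>M)"
    by (intro nn_integral_cmult) measurable
  also have "(\<integral>\<^sup>+x. (\<integral>\<^sup>+r. ?I x r \<partial>lborel) \<partial>M) = (\<integral>\<^sup>+r. (\<integral>\<^sup>+x. ?I x r \<partial>M) \<partial>lborel)"
    by (intro Fubini'[symmetric]) measurable
  also have "\<dots> = (\<integral>\<^sup>+r. indicator {0..<1} r * emeasure M {x \<in> space M. ennreal (A * r) < f x} \<partial>lborel)"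
    by (intro nn_integral_cong) (subst nn_integral_cmult, auto)
  finally show ?thesis by (simp add: mult.commute)
qed

lemma exp_mult_le_convex_combination:
  fixes u c :: real
  assumes "0 < u" "u < 1"
  shows "exp (c * u) \<le> (1 - u) + u * exp c"
proof -
  have "exp ((1 - u) * 0 + u * c) \<le> (1 - u) * exp 0 + u * exp c"
    using convex_onD[OF exp_convex, of u 0 c] assms by simp
  then show ?thesis by (simp add: mult.commute)
qed

lemma borel_measurable_quasiconcave:
  fixes f :: "real \<Rightarrow> ennreal"
  assumes "\<And>s. convex {x. s < f x}"
  shows "f \<in> borel_measurable lborel"
proof -
  have "{x. s < f x} \<in> sets borel" for s
    using assms[of s] by (simp add: is_interval_convex_1[symmetric] real_interval_borel_measurable)
  then show ?thesis
    by (intro borel_measurableI_greater) simp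
qed

text \<open>For positive finite values, \<open>le\<close> for all \<open>c\<close> says that
  \<open>h\<close> at the combined point is at least the weighted geometric mean of
  \<open>f x\<close> and \<open>g y\<close>: choose \<open>c\<close> to equalize the two arguments
  of the minimum. Levels at the same fraction of the suprema of \<open>f\<close> and
  \<open>g\<close> have nonempty superlevel sets, so Brunn-Minkowski applies level by level and is
  then integrated over the levels.\<close>

lemma prekopa_leindler_bounded:
  fixes f g h :: "real \<Rightarrow> ennreal"
  assumes f: "\<And>s. convex {x. s < f x}" and g: "\<And>s. convex {x. s < g x}"
    and h: "h \<in> borel_measurable lborel" and u: "0 < u" "u < 1"
    and le: "\<And>x y c. min (f x) (ennreal (exp c) * g y) \<le> ennreal (exp (c * u)) * h ((1 - u) * x + u * y)"
    and f_fin: "(SUP x. f x) \<noteq> \<top>" and g_fin: "(SUP x. g x) \<noteq> \<top>"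
  shows "min (\<integral>\<^sup>+x. f x \<partial>lborel) (\<integral>\<^sup>+x. g x \<partial>lborel) \<le> (\<integral>\<^sup>+x. h x \<partial>lborel)"
proof (cases "(SUP x. f x) = 0 \<or> (SUP x. g x) = 0")
  case True
  then have "(\<forall>x. f x = 0) \<or> (\<forall>x. g x = 0)"
    by (metis SUP_upper UNIV_I le_zero_eq)
  then have "(\<integral>\<^sup>+x. f x \<partial>lborel) = 0 \<or> (\<integral>\<^sup>+x. g x \<partial>lborel) = 0" by auto
  then have "min (\<integral>\<^sup>+x. f x \<partial>lborel) (\<integral>\<^sup>+x. g x \<partial>lborel) = 0"
    by (elim disjE) (simp_all add: min_def)
  then show ?thesis by simp
next
  case False
  note [measurable] = borel_measurable_quasiconcave[of f, OF f] borel_measurable_quasiconcave[of g, OF g] h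
  obtain A where A: "(SUP x. f x) = ennreal A" "0 < A"
    using f_fin False by (metis ennreal_cases ennreal_0 order_le_less)
  obtain B where B: "(SUP x. g x) = ennreal B" "0 < B"
    using g_fin False by (metis ennreal_cases ennreal_0 order_le_less)
  \<comment> \<open>The tilt by \<open>c\<close> makes the supremum of \<open>g\<close> equal to
    that of \<open>f\<close>; \<open>H\<close> is the weighted geometric mean of \<open>A\<close>
    and \<open>B\<close>, the matching scale for \<open>h\<close>.\<close>
  define c where "c = ln (A / B)"
  define H where "H = A * exp (- (c * u))"
  have H: "0 < H" using A by (simp add: H_def)
  have ecB: "ennreal (exp c) * ennreal B = ennreal A"
    using A B by (simp add: c_def ennreal_mult'[symmetric])
  let ?C = "\<lambda>r. {x. ennreal (A * r) < f x}" and ?D = "\<lambda>r. {x. ennreal (B * r) < g x}"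
    and ?E = "\<lambda>r. {x. ennreal (H * r) < min (h x) (ennreal H)}"
  have level: "ennreal (1 - u) * emeasure lborel (?C r) + ennreal u * emeasure lborel (?D r) \<le> emeasure lborel (?E r)"
    if r: "0 \<le> r" "r < 1" for r
  proof (rule brunn_minkowski_intervals)
    show "convex (?C r)" "convex (?D r)" by (rule f, rule g)
    have "ennreal (A * r) < (SUP x. f x)" "ennreal (B * r) < (SUP x. g x)"
      using A B r by (auto simp: ennreal_less_iff)
    then show "?C r \<noteq> {}" "?D r \<noteq> {}" by (auto simp: less_SUP_iff)
    show "?E r \<in> sets lborel" by measurable
    show "0 < u" "u < 1" by fact+
    fix x y assume x: "x \<in> ?C r" and y: "y \<in> ?D r"
    have "ennreal (A * r) = ennreal (exp c) * ennreal (B * r)"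
      using ecB r A B by (simp add: ennreal_mult mult.assoc[symmetric] less_imp_le)
    also have "\<dots> < ennreal (exp c) * g y"
      using y by (intro ennreal_mult_strict_left_mono) auto
    finally have "ennreal (A * r) < min (f x) (ennreal (exp c) * g y)" using x by simp
    also note le
    finally have *: "ennreal (A * r) < ennreal (exp (c * u)) * h ((1 - u) * x + u * y)" .
    have "ennreal (exp (- (c * u))) * ennreal (A * r)
        < ennreal (exp (- (c * u))) * (ennreal (exp (c * u)) * h ((1 - u) * x + u * y))"
      using * by (intro ennreal_mult_strict_left_mono) auto
    also have "\<dots> = ennreal (exp (- (c * u)) * exp (c * u)) * h ((1 - u) * x + u * y)"
      by (simp add: ennreal_mult' mult.assoc)
    also have "\<dots> = h ((1 - u) * x + u * y)" by (simp add: exp_add[symmetric])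
    finally have "ennreal (H * r) < h ((1 - u) * x + u * y)"
      by (simp add: H_def ennreal_mult'[symmetric] mult.assoc mult.left_commute)
    moreover have "ennreal (H * r) < ennreal H" using H r by (simp add: ennreal_less_iff)
    ultimately show "(1 - u) * x + u * y \<in> ?E r" by simp
  qed
  let ?F = "\<integral>\<^sup>+r\<in>{0..<1}. emeasure lborel (?C r) \<partial>lborel" and ?G = "\<integral>\<^sup>+r\<in>{0..<1}. emeasure lborel (?D r) \<partial>lborel"
  have If: "(\<integral>\<^sup>+x. f x \<partial>lborel) = ennreal A * ?F"
    using A SUP_upper[of _ UNIV f] by (subst nn_integral_layer_cake_bounded[where A=A]) (auto intro: lborel.sigma_finite_measure_axioms)
  have Ig: "(\<integral>\<^sup>+x. g x \<partial>lborel) = ennreal B * ?G"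
    using B SUP_upper[of _ UNIV g] by (subst nn_integral_layer_cake_bounded[where A=B]) (auto intro: lborel.sigma_finite_measure_axioms)
  \<comment> \<open>\<open>h\<close> may be unbounded, so it is cut at \<open>H\<close>. The levels
    \<open>H * r\<close> with r < 1 stay below the cut, so nothing used above is lost.\<close>
  have Ih: "(\<integral>\<^sup>+x. min (h x) (ennreal H) \<partial>lborel) = ennreal H * (\<integral>\<^sup>+r\<in>{0..<1}. emeasure lborel (?E r) \<partial>lborel)"
    using H by (subst nn_integral_layer_cake_bounded[where A=H]) (auto intro: lborel.sigma_finite_measure_axioms)
  let ?m = "min (\<integral>\<^sup>+x. f x \<partial>lborel) (\<integral>\<^sup>+x. g x \<partial>lborel)"
  have mf: "ennreal (1 / A) * ?m \<le> ?F"
  proof -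
    have "ennreal (1 / A) * ?m \<le> ennreal (1 / A) * (ennreal A * ?F)"
      unfolding If by (intro mult_left_mono) auto
    also have "\<dots> = ?F" using A by (simp add: mult.assoc[symmetric] ennreal_mult'[symmetric])
    finally show ?thesis .
  qed
  have mg: "ennreal (1 / B) * ?m \<le> ?G"
  proof -
    have "ennreal (1 / B) * ?m \<le> ennreal (1 / B) * (ennreal B * ?G)"
      unfolding Ig by (intro mult_left_mono) auto
    also have "\<dots> = ?G" using B by (simp add: mult.assoc[symmetric] ennreal_mult'[symmetric])
    finally show ?thesis .
  qed
  \<comment> \<open>The weighted geometric mean \<open>H\<close> dominates the weighted harmonic
    mean of \<open>A\<close> and \<open>B\<close>. This converts the arithmetic average delivered by
    Brunn-Minkowski into a bound on the plain minimum \<open>?m\<close>.\<close>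
  have "1 \<le> H * ((1 - u) / A + u / B)"
  proof -
    have "H * ((1 - u) / A + u / B) = exp (- (c * u)) * ((1 - u) + u * exp c)"
      using A B by (simp add: H_def c_def field_simps)
    also have "\<dots> \<ge> exp (- (c * u)) * exp (c * u)"
      using exp_mult_le_convex_combination[OF u, of c] by (intro mult_left_mono) auto
    finally show ?thesis by (simp add: exp_add[symmetric])
  qed
  then have "?m \<le> ennreal (H * ((1 - u) / A + u / B)) * ?m"
    using mult_right_mono[of 1 "ennreal (H * ((1 - u) / A + u / B))" ?m] by (simp add: ennreal_leI)
  also have "\<dots> = ennreal H * (ennreal (1 - u) * (ennreal (1 / A) * ?m) + ennreal u * (ennreal (1 / B) * ?m))"
  proof -
    have "ennreal (H * ((1 - u) / A + u / B)) = ennreal H * (ennreal (1 - u) * ennreal (1 / A) + ennreal u * ennreal (1 / B))"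
      using H A B u by (simp add: ennreal_mult'[symmetric] ennreal_plus[symmetric] del: ennreal_plus)
    then show ?thesis by (simp add: distrib_right mult.assoc)
  qed
  also have "\<dots> \<le> ennreal H * (ennreal (1 - u) * ?F + ennreal u * ?G)"
    by (intro mult_left_mono add_mono mf mg) auto
  also have "ennreal (1 - u) * ?F + ennreal u * ?G =
      (\<integral>\<^sup>+r\<in>{0..<1}. (ennreal (1 - u) * emeasure lborel (?C r) + ennreal u * emeasure lborel (?D r)) \<partial>lborel)"
  proof -
    have [measurable]: "(\<lambda>r. emeasure lborel (?C r)) \<in> borel_measurable lborel"
      "(\<lambda>r. emeasure lborel (?D r)) \<in> borel_measurable lborel"
      by measurable
    show ?thesis
      by (simp add: distrib_right mult.assoc nn_integral_add nn_integral_cmult)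
  qed
  also have "\<dots> \<le> (\<integral>\<^sup>+r\<in>{0..<1}. emeasure lborel (?E r) \<partial>lborel)"
    using level by (intro nn_integral_mono) (auto simp: indicator_def)
  finally have "?m \<le> (\<integral>\<^sup>+x. min (h x) (ennreal H) \<partial>lborel)"
    unfolding Ih by (simp add: mult_left_mono)
  also have "\<dots> \<le> (\<integral>\<^sup>+x. h x \<partial>lborel)" by (intro nn_integral_mono) auto
  finally show ?thesis .
qed

text \<open>Cutting \<open>f\<close> and \<open>g\<close> at height \<open>m\<close> preserves
  convex superlevel sets and only lowers the left side of \<open>le\<close>; monotone convergence in
  \<open>m\<close> removes the boundedness assumption.\<close>

lemma prekopa_leindler_quasiconcave:
  fixes f g h :: "real \<Rightarrow> ennreal"
  assumes f: "\<And>s. convex {x. s < f x}" and g: "\<And>s. convex {x. s < g x}"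
    and h: "h \<in> borel_measurable lborel" and u: "0 < u" "u < 1"
    and le: "\<And>x y c. min (f x) (ennreal (exp c) * g y) \<le> ennreal (exp (c * u)) * h ((1 - u) * x + u * y)"
  shows "min (\<integral>\<^sup>+x. f x \<partial>lborel) (\<integral>\<^sup>+x. g x \<partial>lborel) \<le> (\<integral>\<^sup>+x. h x \<partial>lborel)"
proof -
  have cut: "(\<lambda>m. \<integral>\<^sup>+x. min (k x) (of_nat m) \<partial>lborel) \<longlonglongrightarrow> (\<integral>\<^sup>+x. k x \<partial>lborel)"
    if k: "\<And>s. convex {x. s < k x}" for k :: "real \<Rightarrow> ennreal"
  proof (rule nn_integral_LIMSEQ)
    note [measurable] = borel_measurable_quasiconcave[of k, OF k]
    show "incseq (\<lambda>m x. min (k x) (of_nat m))"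
      by (intro monoI le_funI min.mono) auto
    show "(\<lambda>x. min (k x) (of_nat m)) \<in> borel_measurable lborel" for m by measurable
    show "(\<lambda>m. min (k x) (of_nat m)) \<longlonglongrightarrow> k x" for x
      using tendsto_min[OF tendsto_const[of "k x"] of_nat_tendsto_top_ennreal] by simp
  qed
  have convex_cut: "convex {x. s < min (k x) (of_nat m)}" if k: "\<And>s. convex {x. s < k x}"
    for k :: "real \<Rightarrow> ennreal" and s and m :: nat
  proof (cases "s < of_nat m")
    case True
    then have "{x. s < min (k x) (of_nat m)} = {x. s < k x}" by auto
    then show ?thesis using k by simp
  qed simp
  have fin: "(SUP x. min (k x) (of_nat m)) \<noteq> \<top>" for k :: "real \<Rightarrow> ennreal" and m :: nat
  proof -
    have "(SUP x. min (k x) (of_nat m)) \<le> of_nat m" by (intro SUP_least) simp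
    also have "\<dots> < \<top>" by (simp add: less_top[symmetric])
    finally show ?thesis by (rule less_imp_neq)
  qed
  have "min (\<integral>\<^sup>+x. min (f x) (of_nat m) \<partial>lborel) (\<integral>\<^sup>+x. min (g x) (of_nat m) \<partial>lborel) \<le> (\<integral>\<^sup>+x. h x \<partial>lborel)" for m
  proof (rule prekopa_leindler_bounded[OF convex_cut[OF f] convex_cut[OF g] h u _ fin fin])
    fix x y c
    show "min (min (f x) (of_nat m)) (ennreal (exp c) * min (g y) (of_nat m))
        \<le> ennreal (exp (c * u)) * h ((1 - u) * x + u * y)"
      by (rule order_trans[OF min.mono le]) (auto intro: mult_left_mono)
  qed
  then show ?thesis
    by (intro LIMSEQ_le_const2[OF tendsto_min[OF cut[OF f] cut[OF g]]]) auto
qed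

text \<open>Log-concavity in \<open>t\<close> and \<open>x\<close> jointly, stated as quasi-concavity of every exponential tilt, so
  that no powers of extended reals occur.\<close>

definition log_concave :: "(real \<Rightarrow> ('i \<Rightarrow> real) \<Rightarrow> ennreal) \<Rightarrow> bool" where
  "log_concave F \<longleftrightarrow> (\<forall>t t' x y c u. 0 < u \<longrightarrow> u < 1 \<longrightarrow>
     min (F t x) (ennreal (exp c) * F t' y)
       \<le> ennreal (exp (c * u)) * F ((1 - u) * t + u * t') (\<lambda>i. (1 - u) * x i + u * y i))"

lemma log_concaveD:
  "log_concave F \<Longrightarrow> 0 < u \<Longrightarrow> u < 1 \<Longrightarrow> min (F t x) (ennreal (exp c) * F t' y)
       \<le> ennreal (exp (c * u)) * F ((1 - u) * t + u * t') (\<lambda>i. (1 - u) * x i + u * y i)"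
  unfolding log_concave_def by blast

section \<open>Stability of log-concavity and evenness under integrating out coordinates\<close>

lemma log_concave_section:
  assumes F: "log_concave F"
  shows "convex {s. b < ennreal (exp c) * F t (x(i := s))}"
  unfolding convex_alt
proof (intro ballI allI impI)
  fix p q u :: real
  assume p: "p \<in> {s. b < ennreal (exp c) * F t (x(i := s))}"
    and q: "q \<in> {s. b < ennreal (exp c) * F t (x(i := s))}" and u: "0 \<le> u \<and> u \<le> 1"
  show "(1 - u) *\<^sub>R p + u *\<^sub>R q \<in> {s. b < ennreal (exp c) * F t (x(i := s))}"
  proof (cases "u = 0 \<or> u = 1")
    case False
    have eq: "(\<lambda>j. (1 - u) * (x(i := p)) j + u * (x(i := q)) j) = x(i := (1 - u) * p + u * q)"
      by (auto simp: algebra_simps)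
    have "min (F t (x(i := p))) (F t (x(i := q))) \<le> F t (x(i := (1 - u) * p + u * q))"
      using log_concaveD[OF F, of u t "x(i := p)" 0 t "x(i := q)"] False u unfolding eq
      by (simp add: algebra_simps)
    moreover have "b < ennreal (exp c) * min (F t (x(i := p))) (F t (x(i := q)))"
      using p q by (simp add: min_def)
    ultimately have "b < ennreal (exp c) * F t (x(i := (1 - u) * p + u * q))"
      by (elim less_le_trans) (intro mult_left_mono, auto)
    then show ?thesis by simp
  qed (use p q in auto)
qed

text \<open>This is Prekopa's theorem for one coordinate. Prekopa-Leindler applies to the sections
  in \<open>s\<close> because tilts compose: tilting the already tilted section by \<open>c'\<close>
  is a tilt by \<open>c' + c\<close>, which the hypothesis on \<open>F\<close> covers.\<close>

lemma log_concave_marginal: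
  fixes F :: "real \<Rightarrow> ('i \<Rightarrow> real) \<Rightarrow> ennreal"
  assumes F: "log_concave F"
  shows "log_concave (\<lambda>t x. \<integral>\<^sup>+s. F t (x(i := s)) \<partial>lborel)"
  unfolding log_concave_def
proof (intro allI impI)
  fix t t' c u :: real and x y :: "'i \<Rightarrow> real"
  assume u: "0 < u" "u < 1"
  let ?t = "(1 - u) * t + u * t'" and ?z = "\<lambda>i. (1 - u) * x i + u * y i"
  have meas: "(\<lambda>s. F t (x(i := s))) \<in> borel_measurable lborel" for t x
    by (rule borel_measurable_quasiconcave) (use log_concave_section[OF F, of _ 0] in simp)
  have "min (\<integral>\<^sup>+s. F t (x(i := s)) \<partial>lborel) (\<integral>\<^sup>+s. ennreal (exp c) * F t' (y(i := s)) \<partial>lborel)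
      \<le> (\<integral>\<^sup>+s. ennreal (exp (c * u)) * F ?t (?z(i := s)) \<partial>lborel)"
  proof (rule prekopa_leindler_quasiconcave)
    show "convex {p. b < F t (x(i := p))}" for b
      using log_concave_section[OF F, of _ 0] by simp
    show "convex {p. b < ennreal (exp c) * F t' (y(i := p))}" for b
      by (rule log_concave_section[OF F])
    show "(\<lambda>s. ennreal (exp (c * u)) * F ?t (?z(i := s))) \<in> borel_measurable lborel"
      using meas by simp
    show "0 < u" "u < 1" by fact+
    fix p q c'
    have "ennreal (exp c') * (ennreal (exp c) * F t' (y(i := q))) = ennreal (exp (c' + c)) * F t' (y(i := q))"
      by (simp add: exp_add ennreal_mult' mult.assoc)
    then have "min (F t (x(i := p))) (ennreal (exp c') * (ennreal (exp c) * F t' (y(i := q))))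
       \<le> ennreal (exp ((c' + c) * u)) * F ?t (\<lambda>j. (1 - u) * (x(i := p)) j + u * (y(i := q)) j)"
      using log_concaveD[OF F u] by metis
    also have "(\<lambda>j. (1 - u) * (x(i := p)) j + u * (y(i := q)) j) = ?z(i := (1 - u) * p + u * q)"
      by auto
    also have "ennreal (exp ((c' + c) * u)) = ennreal (exp (c' * u)) * ennreal (exp (c * u))"
      by (simp add: exp_add ennreal_mult' distrib_right)
    finally show "min (F t (x(i := p))) (ennreal (exp c') * (ennreal (exp c) * F t' (y(i := q))))
       \<le> ennreal (exp (c' * u)) * (ennreal (exp (c * u)) * F ?t (?z(i := (1 - u) * p + u * q)))"
      unfolding mult.assoc .
  qed
  then show "min (\<integral>\<^sup>+s. F t (x(i := s)) \<partial>lborel) (ennreal (exp c) * (\<integral>\<^sup>+s. F t' (y(i := s)) \<partial>lborel))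
      \<le> ennreal (exp (c * u)) * (\<integral>\<^sup>+s. F ?t (?z(i := s)) \<partial>lborel)"
    unfolding nn_integral_cmult[OF meas] .
qed

text \<open>Lebesgue measure is invariant under the reflection of \<open>s\<close>, and that
  reflection supplies the sign change missing in coordinate \<open>i\<close>.\<close>

lemma even_marginal:
  fixes F :: "real \<Rightarrow> ('i \<Rightarrow> real) \<Rightarrow> ennreal"
  assumes F: "log_concave F"
    and even: "\<And>t x. F (- t) (\<lambda>j. if j \<in> insert i I then - x j else x j) = F t x"
  shows "(\<integral>\<^sup>+s. F (- t) ((\<lambda>j. if j \<in> I then - x j else x j)(i := s)) \<partial>lborel) = (\<integral>\<^sup>+s. F t (x(i := s)) \<partial>lborel)"
proof -
  have meas: "(\<lambda>s. F t (x(i := s))) \<in> borel_measurable borel" for t x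
    using borel_measurable_quasiconcave[of "\<lambda>s. F t (x(i := s))"] log_concave_section[OF F, of _ 0] by simp
  have neg: "(\<lambda>j. if j \<in> I then - x j else x j)(i := - s)
      = (\<lambda>j. if j \<in> insert i I then - (x(i := s)) j else (x(i := s)) j)" for s by auto
  have "(\<integral>\<^sup>+s. F (- t) ((\<lambda>j. if j \<in> I then - x j else x j)(i := s)) \<partial>lborel)
      = (\<integral>\<^sup>+s. F (- t) ((\<lambda>j. if j \<in> I then - x j else x j)(i := - s)) \<partial>lborel)"
    by (subst nn_integral_real_affine[where c="-1" and t=0]) (use meas in auto)
  then show ?thesis unfolding neg even .
qed

text \<open>The induction removes one coordinate at a time. It has to carry full log-concavity,
  since quasi-concavity alone is not inherited by marginals; the conclusion keeps only the
  quasi-concavity and evenness in \<open>t\<close>.\<close>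

lemma log_concave_even_marginal_PiM:
  fixes F :: "real \<Rightarrow> ('i \<Rightarrow> real) \<Rightarrow> ennreal"
  assumes "finite I" and "log_concave F" and "\<And>t x. F (- t) (\<lambda>j. if j \<in> I then - x j else x j) = F t x"
    and "\<And>t. F t \<in> borel_measurable (\<Pi>\<^sub>M i\<in>I. lborel)"
  defines "\<psi> \<equiv> \<lambda>t. \<integral>\<^sup>+x. F t x \<partial>(\<Pi>\<^sub>M i\<in>I. lborel)"
  shows "(\<forall>t t' u. 0 < u \<longrightarrow> u < 1 \<longrightarrow> min (\<psi> t) (\<psi> t') \<le> \<psi> ((1 - u) * t + u * t')) \<and> (\<forall>t. \<psi> (- t) = \<psi> t)"
  using assms(1-4) unfolding \<psi>_def
proof (induction I arbitrary: F)
  case empty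
  interpret product_sigma_finite "\<lambda>_::'i. lborel :: real measure" ..
  let ?o = "\<lambda>_::'i. undefined :: real"
  \<comment> \<open>The product over the empty index set has the single point
    \<open>undefined\<close> everywhere, and a convex combination of it with itself is the same
    point.\<close>
  have o: "(\<lambda>i. (1 - u) * ?o i + u * ?o i) = ?o" for u by (auto simp: algebra_simps)
  have "min (F t ?o) (F t' ?o) \<le> F ((1 - u) * t + u * t') ?o" if "0 < u" "u < 1" for t t' u
    using log_concaveD[OF empty(1) that, of t ?o 0 t' ?o] unfolding o by simp
  moreover have "F (- t) ?o = F t ?o" for t
    using empty(2)[of t ?o] by simp
  ultimately show ?case by (simp add: PiM_empty nn_integral_count_space_finite)
next
  case (insert i I)
  interpret product_sigma_finite "\<lambda>_::'i. lborel :: real measure" ..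
  let ?G = "\<lambda>t x. \<integral>\<^sup>+s. F t (x(i := s)) \<partial>lborel"
  have meas: "?G t \<in> borel_measurable (\<Pi>\<^sub>M i\<in>I. lborel)" for t
  proof (rule lborel.borel_measurable_nn_integral)
    show "case_prod (\<lambda>x s. F t (x(i := s))) \<in> borel_measurable ((\<Pi>\<^sub>M i\<in>I. lborel) \<Otimes>\<^sub>M lborel)"
      using measurable_compose[OF measurable_add_dim[of i I "\<lambda>_. lborel"] insert.prems(3)[of t]]
      by (simp only: split_beta' split_beta)
  qed
  have lc: "log_concave ?G" by (rule log_concave_marginal[of F i, OF insert.prems(1)])
  have even: "?G (- t) (\<lambda>j. if j \<in> I then - x j else x j) = ?G t x" for t x
    by (rule even_marginal[of F i I, OF insert.prems(1,2)])
  from insert.IH[of ?G, OF lc even meas]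
  show ?case unfolding product_nn_integral_insert[OF insert.hyps insert.prems(3)] .
qed

subsection \<open>Correlation of a slab with a symmetric convex set\<close>

lemma PiM_density:
  fixes M :: "'i \<Rightarrow> 'a measure" and f :: "'i \<Rightarrow> 'a \<Rightarrow> ennreal"
  assumes A: "finite A" and M: "\<And>i. sigma_finite_measure (M i)"
    and D: "\<And>i. sigma_finite_measure (density (M i) (f i))"
    and f: "\<And>i. f i \<in> borel_measurable (M i)"
  shows "(\<Pi>\<^sub>M i\<in>A. density (M i) (f i)) = density (Pi\<^sub>M A M) (\<lambda>x. \<Prod>i\<in>A. f i (x i))"
proof (rule sym, rule product_sigma_finite.PiM_eqI)
  interpret M: product_sigma_finite M by (simp add: product_sigma_finite_def M)
  have prod: "(\<lambda>x. \<Prod>i\<in>A. f i (x i)) \<in> borel_measurable (Pi\<^sub>M A M)"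
    using f by (intro borel_measurable_prod_ennreal measurable_compose[OF measurable_component_singleton]) auto
  show "product_sigma_finite (\<lambda>i. density (M i) (f i))"
    by (simp add: product_sigma_finite_def D)
  show "finite A" by fact
  show "sets (density (Pi\<^sub>M A M) (\<lambda>x. \<Prod>i\<in>A. f i (x i))) = sets (\<Pi>\<^sub>M i\<in>A. density (M i) (f i))"
    by (auto intro!: sets_PiM_cong)
  fix B assume "\<And>i. i \<in> A \<Longrightarrow> B i \<in> sets (density (M i) (f i))"
  then have B: "\<And>i. i \<in> A \<Longrightarrow> B i \<in> sets (M i)" by simp
  have "emeasure (density (Pi\<^sub>M A M) (\<lambda>x. \<Prod>i\<in>A. f i (x i))) (Pi\<^sub>E A B)
      = (\<integral>\<^sup>+x. (\<Prod>i\<in>A. f i (x i)) * indicator (Pi\<^sub>E A B) x \<partial>Pi\<^sub>M A M)"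
    using A B prod by (intro emeasure_density sets_PiM_I_finite) auto
  also have "\<dots> = (\<integral>\<^sup>+x. (\<Prod>i\<in>A. f i (x i) * indicator (B i) (x i)) \<partial>Pi\<^sub>M A M)"
  proof (rule nn_integral_cong)
    fix x assume "x \<in> space (Pi\<^sub>M A M)"
    then have "indicator (Pi\<^sub>E A B) x = (\<Prod>i\<in>A. indicator (B i) (x i) :: ennreal)"
      using A by (auto simp: space_PiM PiE_iff indicator_def prod_zero_iff)
    then show "(\<Prod>i\<in>A. f i (x i)) * indicator (Pi\<^sub>E A B) x = (\<Prod>i\<in>A. f i (x i) * indicator (B i) (x i))"
      by (simp add: prod.distrib)
  qed
  also have "\<dots> = (\<Prod>i\<in>A. \<integral>\<^sup>+x. f i x * indicator (B i) x \<partial>M i)"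
    using A B f by (intro M.product_nn_integral_prod) auto
  also have "\<dots> = (\<Prod>i\<in>A. emeasure (density (M i) (f i)) (B i))"
    using B f by (intro prod.cong refl emeasure_density[symmetric]) auto
  finally show "emeasure (density (Pi\<^sub>M A M) (\<lambda>x. \<Prod>i\<in>A. f i (x i))) (Pi\<^sub>E A B)
      = (\<Prod>i\<in>A. emeasure (density (M i) (f i)) (B i))" .
qed

definition gauss :: "real \<Rightarrow> real measure" where
  "gauss \<sigma> = density lborel (\<lambda>t. ennreal (normal_density 0 \<sigma> t))"

lemma sets_gauss [simp, measurable_cong]: "sets (gauss \<sigma>) = sets borel"
  and space_gauss [simp]: "space (gauss \<sigma>) = UNIV"
  by (simp_all add: gauss_def)

lemma prob_space_gauss: "0 < \<sigma> \<Longrightarrow> prob_space (gauss \<sigma>)"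
  unfolding gauss_def by (rule prob_space_normal_density)

text \<open>For a unit vector \<open>v\<close>, the Gaussian density at \<open>x\<close> divided by the one-dimensional density at
  \<open>t = \<langle>v, x\<rangle>\<close> is a constant times \<open>exp (- defect A v x / (2 * \<sigma>\<^sup>2))\<close>. This is log-concave because the
  defect is a positive semidefinite quadratic form. The map \<open>hyperplane_point\<close> solves
  \<open>\<langle>v, x\<rangle> = t\<close> for coordinate \<open>i\<close>; it replaces a rotation taking \<open>v\<close> to a basis vector.\<close>

definition defect :: "'i set \<Rightarrow> ('i \<Rightarrow> real) \<Rightarrow> ('i \<Rightarrow> real) \<Rightarrow> real" where
  "defect A v x = (\<Sum>j\<in>A. (x j)\<^sup>2) - (\<Sum>j\<in>A. v j * x j)\<^sup>2"

definition hyperplane_point :: "'i \<Rightarrow> 'i set \<Rightarrow> ('i \<Rightarrow> real) \<Rightarrow> real \<Rightarrow> ('i \<Rightarrow> real) \<Rightarrow> 'i \<Rightarrow> real" where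
  "hyperplane_point i I v t y = y(i := (t - (\<Sum>j\<in>I. v j * y j)) / v i)"

lemma hyperplane_point_sum:
  assumes "finite I" "i \<notin> I" "v i \<noteq> 0"
  shows "(\<Sum>j\<in>insert i I. v j * hyperplane_point i I v t y j) = t"
proof -
  have "(\<Sum>j\<in>I. v j * hyperplane_point i I v t y j) = (\<Sum>j\<in>I. v j * y j)"
    using assms by (intro sum.cong) (auto simp: hyperplane_point_def)
  then show ?thesis using assms by (simp add: hyperplane_point_def)
qed

lemma defect_nonneg:
  assumes "finite A" "(\<Sum>j\<in>A. (v j)\<^sup>2) = 1"
  shows "0 \<le> defect A v x"
  using Cauchy_Schwarz_ineq_sum[of v x A] assms(2) by (simp add: defect_def)

text \<open>This is the exact second-order identity of a quadratic form. For a unit vector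
  \<open>v\<close> the remainder is nonnegative by Cauchy-Schwarz, which makes the defect
  convex.\<close>

lemma defect_convex_combination:
  "(1 - u) * defect A v x + u * defect A v y
    = defect A v (\<lambda>j. (1 - u) * x j + u * y j) + u * (1 - u) * defect A v (\<lambda>j. x j - y j)"
proof -
  have 1: "(1 - u) * (\<Sum>j\<in>A. (x j)\<^sup>2) + u * (\<Sum>j\<in>A. (y j)\<^sup>2)
      = (\<Sum>j\<in>A. ((1 - u) * x j + u * y j)\<^sup>2) + u * (1 - u) * (\<Sum>j\<in>A. (x j - y j)\<^sup>2)"
    unfolding sum_distrib_left sum.distrib[symmetric]
    by (intro sum.cong) (auto simp: power2_eq_square algebra_simps)
  have 2: "(\<Sum>j\<in>A. v j * ((1 - u) * x j + u * y j)) = (1 - u) * (\<Sum>j\<in>A. v j * x j) + u * (\<Sum>j\<in>A. v j * y j)"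
    unfolding sum_distrib_left sum.distrib[symmetric]
    by (intro sum.cong) (auto simp: algebra_simps)
  have 3: "(\<Sum>j\<in>A. v j * (x j - y j)) = (\<Sum>j\<in>A. v j * x j) - (\<Sum>j\<in>A. v j * y j)"
    by (simp add: algebra_simps sum_subtractf)
  have 4: "(1 - u) * p\<^sup>2 + u * q\<^sup>2 = ((1 - u) * p + u * q)\<^sup>2 + u * (1 - u) * (p - q)\<^sup>2" for p q :: real
    by (simp add: power2_eq_square algebra_simps)
  show ?thesis
    unfolding defect_def 2 3 using 1 4[of "\<Sum>j\<in>A. v j * x j" "\<Sum>j\<in>A. v j * y j"]
    by (simp add: right_diff_distrib)
qed

lemma prod_normal_density:
  assumes "finite A"
  shows "(\<Prod>j\<in>A. normal_density 0 \<sigma> (x j))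
    = (1 / sqrt (2 * pi * \<sigma>\<^sup>2)) ^ card A * exp (- (\<Sum>j\<in>A. (x j)\<^sup>2) / (2 * \<sigma>\<^sup>2))"
proof -
  have "(\<Prod>j\<in>A. normal_density 0 \<sigma> (x j)) = (\<Prod>j\<in>A. 1 / sqrt (2 * pi * \<sigma>\<^sup>2) * exp (- (x j)\<^sup>2 / (2 * \<sigma>\<^sup>2)))"
    by (simp add: normal_density_def)
  also have "\<dots> = (1 / sqrt (2 * pi * \<sigma>\<^sup>2)) ^ card A * (\<Prod>j\<in>A. exp (- (x j)\<^sup>2 / (2 * \<sigma>\<^sup>2)))"
    unfolding prod.distrib prod_constant ..
  also have "(\<Prod>j\<in>A. exp (- (x j)\<^sup>2 / (2 * \<sigma>\<^sup>2))) = exp (\<Sum>j\<in>A. - (x j)\<^sup>2 / (2 * \<sigma>\<^sup>2))"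
    by (rule exp_sum[symmetric]) fact
  also have "(\<Sum>j\<in>A. - (x j)\<^sup>2 / (2 * \<sigma>\<^sup>2)) = - (\<Sum>j\<in>A. (x j)\<^sup>2) / (2 * \<sigma>\<^sup>2)"
    unfolding sum_divide_distrib[symmetric] sum_negf ..
  finally show ?thesis .
qed

text \<open>With the coordinates in \<open>I\<close> fixed, coordinate \<open>i\<close> is replaced
  by the inner product \<open>t\<close> of \<open>v\<close> and \<open>x\<close>, an affine
  substitution with Jacobian 1 / |v i|. The Gaussian density splits accordingly and Tonelli moves
  \<open>t\<close> to the outside.\<close>

lemma nn_integral_gauss_hyperplanes:
  fixes v :: "'i \<Rightarrow> real"
  assumes I: "finite I" "i \<notin> I" and vi: "v i \<noteq> 0" and \<sigma>: "0 < \<sigma>"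
    and f: "f \<in> borel_measurable (\<Pi>\<^sub>M j\<in>insert i I. lborel)"
  shows "(\<integral>\<^sup>+x. f x \<partial>(\<Pi>\<^sub>M j\<in>insert i I. gauss \<sigma>))
    = (\<integral>\<^sup>+t. (\<integral>\<^sup>+y. f (hyperplane_point i I v t y)
          * ennreal ((1 / sqrt (2 * pi * \<sigma>\<^sup>2)) ^ card I / \<bar>v i\<bar>
              * exp (- defect (insert i I) v (hyperplane_point i I v t y) / (2 * \<sigma>\<^sup>2)))
          \<partial>(\<Pi>\<^sub>M j\<in>I. lborel)) \<partial>gauss \<sigma>)"
proof -
  let ?A = "insert i I" and ?L = "\<lambda>J. \<Pi>\<^sub>M j\<in>J. (lborel :: real measure)" and ?P = "hyperplane_point i I v"
  interpret product_sigma_finite "\<lambda>_::'i. lborel :: real measure" ..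
  interpret I: finite_product_sigma_finite "\<lambda>_::'i. lborel :: real measure" I by standard fact
  interpret pair_sigma_finite "?L I" "lborel :: real measure" ..
  define C where "C = (1 / sqrt (2 * pi * \<sigma>\<^sup>2)) ^ card I / \<bar>v i\<bar>"
  define D where "D x = ennreal (\<Prod>j\<in>?A. normal_density 0 \<sigma> (x j))" for x
  define E where "E x = ennreal (C * exp (- defect ?A v x / (2 * \<sigma>\<^sup>2)))" for x
  have Dm [measurable]: "D \<in> borel_measurable (?L ?A)" unfolding D_def by measurable
  have fm [measurable]: "f \<in> borel_measurable (?L ?A)" by fact
  have upd: "(\<lambda>p. (snd p)(i := g p)) \<in> measurable (lborel \<Otimes>\<^sub>M ?L I) (?L ?A)"
    if "g \<in> measurable (lborel \<Otimes>\<^sub>M ?L I) lborel" for g :: "real \<times> ('i \<Rightarrow> real) \<Rightarrow> real"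
    using measurable_compose[OF measurable_Pair[OF measurable_snd that] measurable_add_dim[of i I "\<lambda>_. lborel"]]
    by (simp only: prod.case)
  have dens: "(\<Pi>\<^sub>M j\<in>?A. gauss \<sigma>) = density (?L ?A) D"
    unfolding gauss_def D_def using I \<sigma>
    by (subst PiM_density) (auto simp: prod_ennreal intro!: lborel.sigma_finite_measure_axioms
        prob_space_imp_sigma_finite prob_space_normal_density)
  \<comment> \<open>The sum of squares is the defect plus the square of \<open>t\<close>. One of the
    normalizing factors goes into the density of \<open>t\<close>, so \<open>card I\<close> of them
    remain.\<close>
  have pt: "ennreal (1 / \<bar>v i\<bar>) * (D x * f x) = ennreal (normal_density 0 \<sigma> t) * (f x * E x)"
    if t: "(\<Sum>j\<in>?A. v j * x j) = t" for x t
  proof -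
    have sq: "(\<Sum>j\<in>?A. (x j)\<^sup>2) = defect ?A v x + t\<^sup>2" unfolding defect_def t by simp
    have ex: "exp (- (defect ?A v x + t\<^sup>2) / (2 * \<sigma>\<^sup>2)) = exp (- t\<^sup>2 / (2 * \<sigma>\<^sup>2)) * exp (- defect ?A v x / (2 * \<sigma>\<^sup>2))"
      by (simp add: exp_add[symmetric] add_divide_distrib diff_divide_distrib)
    have "1 / \<bar>v i\<bar> * (\<Prod>j\<in>?A. normal_density 0 \<sigma> (x j))
        = normal_density 0 \<sigma> t * (C * exp (- defect ?A v x / (2 * \<sigma>\<^sup>2)))"
      using I \<sigma> unfolding prod_normal_density[OF finite.insertI[OF I(1)]] sq ex
      by (simp add: C_def normal_density_def mult_ac)
    then have "ennreal (1 / \<bar>v i\<bar>) * D x = ennreal (normal_density 0 \<sigma> t) * E x"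
      unfolding D_def E_def by (simp add: ennreal_mult'[symmetric])
    then show ?thesis by (metis mult.assoc mult.commute)
  qed
  have Em: "E \<in> borel_measurable (?L ?A)" unfolding E_def defect_def by measurable
  have Pm: "(\<lambda>p. ?P (fst p) (snd p)) \<in> measurable (lborel \<Otimes>\<^sub>M ?L I) (?L ?A)"
    unfolding hyperplane_point_def by (rule upd) measurable
  have fE: "(\<lambda>p. f (?P (fst p) (snd p)) * E (?P (fst p) (snd p))) \<in> borel_measurable (lborel \<Otimes>\<^sub>M ?L I)"
    by (intro borel_measurable_times_ennreal measurable_compose[OF Pm fm] measurable_compose[OF Pm Em])
  have DF: "(\<lambda>x. D x * f x) \<in> borel_measurable (?L ?A)" by measurable
  have "(\<integral>\<^sup>+x. f x \<partial>(\<Pi>\<^sub>M j\<in>?A. gauss \<sigma>)) = (\<integral>\<^sup>+x. D x * f x \<partial>?L ?A)"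
    unfolding dens by (rule nn_integral_density[OF Dm fm])
  also have "\<dots> = (\<integral>\<^sup>+y. \<integral>\<^sup>+s. D (y(i := s)) * f (y(i := s)) \<partial>lborel \<partial>?L I)"
    by (rule product_nn_integral_insert[OF I DF])
  also have "\<dots> = (\<integral>\<^sup>+y. \<integral>\<^sup>+t. ennreal (normal_density 0 \<sigma> t) * (f (?P t y) * E (?P t y)) \<partial>lborel \<partial>?L I)"
  proof (rule nn_integral_cong)
    fix y assume y: "y \<in> space (?L I)"
    let ?S = "\<Sum>j\<in>I. v j * y j"
    have m: "(\<lambda>s. D (y(i := s)) * f (y(i := s))) \<in> borel_measurable lborel"
      using measurable_compose[OF measurable_compose[OF measurable_Pair1'[OF y] measurable_add_dim[of i I "\<lambda>_. lborel"]] DF]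
      by (simp only: prod.case)
    have eq: "y(i := - ?S / v i + 1 / v i * t) = ?P t y" for t
      using vi by (auto simp: hyperplane_point_def fun_eq_iff field_simps)
    have "(\<integral>\<^sup>+s. D (y(i := s)) * f (y(i := s)) \<partial>lborel)
        = ennreal \<bar>1 / v i\<bar> * (\<integral>\<^sup>+t. D (y(i := - ?S / v i + 1 / v i * t)) * f (y(i := - ?S / v i + 1 / v i * t)) \<partial>lborel)"
      using m vi by (intro nn_integral_real_affine) auto
    also have "\<dots> = ennreal \<bar>1 / v i\<bar> * (\<integral>\<^sup>+t. D (?P t y) * f (?P t y) \<partial>lborel)"
      unfolding eq ..
    also have "\<dots> = (\<integral>\<^sup>+t. ennreal (1 / \<bar>v i\<bar>) * (D (?P t y) * f (?P t y)) \<partial>lborel)"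
    proof -
      have "(\<lambda>t. ?P t y) \<in> measurable lborel (?L ?A)"
        using measurable_compose[OF measurable_Pair2'[OF y] Pm] by (simp only: fst_conv snd_conv)
      then have "(\<lambda>t. D (?P t y) * f (?P t y)) \<in> borel_measurable lborel"
        by (rule measurable_compose[OF _ DF])
      then show ?thesis by (simp add: nn_integral_cmult)
    qed
    also have "\<dots> = (\<integral>\<^sup>+t. ennreal (normal_density 0 \<sigma> t) * (f (?P t y) * E (?P t y)) \<partial>lborel)"
      by (intro nn_integral_cong pt hyperplane_point_sum I vi)
    finally show "(\<integral>\<^sup>+s. D (y(i := s)) * f (y(i := s)) \<partial>lborel)
        = (\<integral>\<^sup>+t. ennreal (normal_density 0 \<sigma> t) * (f (?P t y) * E (?P t y)) \<partial>lborel)" .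
  qed
  also have "\<dots> = (\<integral>\<^sup>+t. \<integral>\<^sup>+y. ennreal (normal_density 0 \<sigma> t) * (f (?P t y) * E (?P t y)) \<partial>?L I \<partial>lborel)"
  proof (rule Fubini'[symmetric])
    show "(\<lambda>(y, t). ennreal (normal_density 0 \<sigma> t) * (f (?P t y) * E (?P t y))) \<in> borel_measurable (?L I \<Otimes>\<^sub>M lborel)"
      using measurable_compose[OF measurable_pair_swap' fE]
      by (auto simp: split_beta' intro!: borel_measurable_times_ennreal)
  qed
  also have "\<dots> = (\<integral>\<^sup>+t. ennreal (normal_density 0 \<sigma> t) * (\<integral>\<^sup>+y. f (?P t y) * E (?P t y) \<partial>?L I) \<partial>lborel)"
  proof (intro nn_integral_cong nn_integral_cmult)
    show "(\<lambda>y. f (?P t y) * E (?P t y)) \<in> borel_measurable (?L I)" for t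
      using measurable_compose[OF measurable_Pair1'[of t lborel "?L I"] fE] by simp
  qed
  also have "\<dots> = (\<integral>\<^sup>+t. (\<integral>\<^sup>+y. f (?P t y) * E (?P t y) \<partial>?L I) \<partial>gauss \<sigma>)"
    unfolding gauss_def
  proof (rule nn_integral_density[symmetric])
    show "(\<lambda>t. \<integral>\<^sup>+y. f (?P t y) * E (?P t y) \<partial>?L I) \<in> borel_measurable lborel"
      using I.borel_measurable_nn_integral_fst[OF fE] by simp
  qed simp
  finally show ?thesis unfolding E_def C_def .
qed

lemma hyperplane_point_convex_combination:
  "hyperplane_point i I v ((1 - u) * t + u * t') (\<lambda>j. (1 - u) * x j + u * y j)
    = (\<lambda>j. (1 - u) * hyperplane_point i I v t x j + u * hyperplane_point i I v t' y j)"
proof -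
  have "(\<Sum>j\<in>I. v j * ((1 - u) * x j + u * y j)) = (1 - u) * (\<Sum>j\<in>I. v j * x j) + u * (\<Sum>j\<in>I. v j * y j)"
    unfolding sum_distrib_left sum.distrib[symmetric]
    by (intro sum.cong) (auto simp: algebra_simps)
  then show ?thesis
    by (auto simp: hyperplane_point_def fun_eq_iff diff_divide_distrib add_divide_distrib right_diff_distrib)
qed

lemma hyperplane_point_uminus:
  assumes "i \<notin> I"
  shows "hyperplane_point i I v (- t) (\<lambda>j. if j \<in> I then - x j else x j)
    = (\<lambda>j. if j \<in> insert i I then - hyperplane_point i I v t x j else hyperplane_point i I v t x j)"
proof -
  have "(\<Sum>j\<in>I. v j * (if j \<in> I then - x j else x j)) = - (\<Sum>j\<in>I. v j * x j)"
    unfolding sum_negf[symmetric] by (intro sum.cong) auto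
  then show ?thesis
    by (auto simp: hyperplane_point_def fun_eq_iff diff_divide_distrib add_divide_distrib)
qed

lemma defect_uminus: "defect A v (\<lambda>j. if j \<in> A then - x j else x j) = defect A v x"
proof -
  have "(\<Sum>j\<in>A. (if j \<in> A then - x j else x j)\<^sup>2) = (\<Sum>j\<in>A. (x j)\<^sup>2)"
    by (intro sum.cong) auto
  moreover have "(\<Sum>j\<in>A. v j * (if j \<in> A then - x j else x j)) = - (\<Sum>j\<in>A. v j * x j)"
    unfolding sum_negf[symmetric] by (intro sum.cong) auto
  ultimately show ?thesis by (simp add: defect_def)
qed

lemma measurable_hyperplane_point:
  "hyperplane_point i I v t \<in> measurable (\<Pi>\<^sub>M j\<in>I. lborel) (\<Pi>\<^sub>M j\<in>insert i I. lborel)"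
proof -
  have "(\<lambda>y. (y, (t - (\<Sum>j\<in>I. v j * y j)) / v i)) \<in> measurable (\<Pi>\<^sub>M j\<in>I. lborel) ((\<Pi>\<^sub>M j\<in>I. lborel) \<Otimes>\<^sub>M lborel)"
    by measurable
  from measurable_compose[OF this measurable_add_dim[of i I "\<lambda>_. lborel"]]
  show ?thesis unfolding hyperplane_point_def[abs_def] by (simp only: prod.case)
qed

text \<open>Convexity of \<open>K\<close> handles the indicator and convexity of the defect makes
  the exponent concave. Of \<open>P\<close> only joint affinity in \<open>t\<close> and
  \<open>x\<close> enters.\<close>

lemma log_concave_exp_defect:
  fixes K :: "('i \<Rightarrow> real) set" and P :: "real \<Rightarrow> ('i \<Rightarrow> real) \<Rightarrow> 'i \<Rightarrow> real"
  assumes A: "finite A" "(\<Sum>j\<in>A. (v j)\<^sup>2) = 1" and C: "0 \<le> C" and r: "0 < r"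
    and conv: "\<And>x y u. x \<in> K \<Longrightarrow> y \<in> K \<Longrightarrow> 0 < u \<Longrightarrow> u < 1 \<Longrightarrow> (\<lambda>j\<in>A. (1 - u) * x j + u * y j) \<in> K"
    and P: "\<And>t t' x y u. P ((1 - u) * t + u * t') (\<lambda>j. (1 - u) * x j + u * y j) = (\<lambda>j. (1 - u) * P t x j + u * P t' y j)"
  shows "log_concave (\<lambda>t x. indicator K (restrict (P t x) A) * ennreal (C * exp (- defect A v (P t x) / r)))"
  unfolding log_concave_def
proof (intro allI impI)
  fix t t' c u :: real and x y :: "'i \<Rightarrow> real"
  assume u: "0 < u" "u < 1"
  let ?z = "\<lambda>j. (1 - u) * P t x j + u * P t' y j"
  let ?d = "\<lambda>x. defect A v x / r"
  show "min (indicator K (restrict (P t x) A) * ennreal (C * exp (- defect A v (P t x) / r)))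
          (ennreal (exp c) * (indicator K (restrict (P t' y) A) * ennreal (C * exp (- defect A v (P t' y) / r))))
        \<le> ennreal (exp (c * u)) * (indicator K (restrict (P ((1 - u) * t + u * t') (\<lambda>j. (1 - u) * x j + u * y j)) A)
          * ennreal (C * exp (- defect A v (P ((1 - u) * t + u * t') (\<lambda>j. (1 - u) * x j + u * y j)) / r)))"
    unfolding P
  proof (cases "restrict (P t x) A \<in> K \<and> restrict (P t' y) A \<in> K")
    case True
    have "(\<lambda>j\<in>A. (1 - u) * restrict (P t x) A j + u * restrict (P t' y) A j) = restrict ?z A"
      by auto
    then have z: "restrict ?z A \<in> K" using conv[of "restrict (P t x) A" "restrict (P t' y) A" u] True u by simp
    have "0 \<le> u * (1 - u) * defect A v (\<lambda>j. P t x j - P t' y j)"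
      using u defect_nonneg[OF A] by simp
    then have "defect A v ?z \<le> (1 - u) * defect A v (P t x) + u * defect A v (P t' y)"
      using defect_convex_combination[of u A v "P t x" "P t' y"] by linarith
    then have "?d ?z \<le> ((1 - u) * defect A v (P t x) + u * defect A v (P t' y)) / r"
      using r by (intro divide_right_mono) auto
    then have d: "?d ?z \<le> (1 - u) * ?d (P t x) + u * ?d (P t' y)"
      by (simp add: add_divide_distrib)
    \<comment> \<open>The tilted minimum of exponents is bounded by their weighted average, where
      the tilt contributes exactly \<open>c * u\<close>.\<close>
    have "min (- ?d (P t x)) (c - ?d (P t' y)) = (1 - u) * min (- ?d (P t x)) (c - ?d (P t' y)) + u * min (- ?d (P t x)) (c - ?d (P t' y))"
      by (simp add: algebra_simps)
    also have "\<dots> \<le> (1 - u) * (- ?d (P t x)) + u * (c - ?d (P t' y))"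
      using u by (intro add_mono mult_left_mono) auto
    also have "\<dots> \<le> c * u - ?d ?z" using d by (simp add: algebra_simps)
    finally have "min (exp (- ?d (P t x))) (exp (c - ?d (P t' y))) \<le> exp (c * u - ?d ?z)"
      by (auto simp: min_def split: if_splits)
    then have "C * min (exp (- ?d (P t x))) (exp (c - ?d (P t' y))) \<le> C * exp (c * u - ?d ?z)"
      using C by (rule mult_left_mono)
    moreover have "min (C * exp (- ?d (P t x))) (C * exp (c - ?d (P t' y))) \<le> C * min (exp (- ?d (P t x))) (exp (c - ?d (P t' y)))"
      by (auto simp: min_def)
    moreover have "exp c * (C * exp (- ?d (P t' y))) = C * exp (c - ?d (P t' y))"
      "exp (c * u) * (C * exp (- ?d ?z)) = C * exp (c * u - ?d ?z)"
      by (simp_all add: exp_diff exp_minus divide_inverse)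
    ultimately have "min (C * exp (- ?d (P t x))) (exp c * (C * exp (- ?d (P t' y)))) \<le> exp (c * u) * (C * exp (- ?d ?z))"
      by linarith
    then have "ennreal (min (C * exp (- ?d (P t x))) (exp c * (C * exp (- ?d (P t' y)))))
        \<le> ennreal (exp (c * u) * (C * exp (- ?d ?z)))"
      by (rule ennreal_leI)
    then have "min (ennreal (C * exp (- ?d (P t x)))) (ennreal (exp c) * ennreal (C * exp (- ?d (P t' y))))
        \<le> ennreal (exp (c * u)) * ennreal (C * exp (- ?d ?z))"
      by (simp only: ennreal_mult'[symmetric] exp_ge_zero min_ennreal mult_nonneg_nonneg C)
    then show "min (indicator K (restrict (P t x) A) * ennreal (C * exp (- defect A v (P t x) / r)))
          (ennreal (exp c) * (indicator K (restrict (P t' y) A) * ennreal (C * exp (- defect A v (P t' y) / r))))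
        \<le> ennreal (exp (c * u)) * (indicator K (restrict ?z A) * ennreal (C * exp (- defect A v ?z / r)))"
      using True z by simp
  qed auto
qed

lemma even_quasiconcave_antimono_abs:
  fixes \<psi> :: "real \<Rightarrow> ennreal"
  assumes qc: "\<And>t t' u. 0 < u \<Longrightarrow> u < 1 \<Longrightarrow> min (\<psi> t) (\<psi> t') \<le> \<psi> ((1 - u) * t + u * t')"
    and even: "\<And>t. \<psi> (- t) = \<psi> t" and st: "\<bar>s\<bar> \<le> \<bar>t\<bar>"
  shows "\<psi> t \<le> \<psi> s"
proof (cases "s = t \<or> s = - t")
  case False
  then have lt: "\<bar>s\<bar> < \<bar>t\<bar>" using st by (auto simp: abs_if split: if_splits)
  \<comment> \<open>\<open>u\<close> is the solution of \<open>(1 - u) * t + u * (- t) = s\<close>,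
    so that quasi-concavity between \<open>t\<close> and its reflection, where \<psi> has equal
    values, bounds the value at \<open>s\<close>.\<close>
  define u where "u = (1 - s / t) / 2"
  have "t \<noteq> 0" using lt by auto
  have "\<bar>s / t\<bar> < 1" using lt by (simp add: abs_divide)
  then have "s / t < 1" "- 1 < s / t" by linarith+
  then have u: "0 < u" "u < 1" by (auto simp: u_def)
  have "(1 - u) * t + u * (- t) = s" using \<open>t \<noteq> 0\<close> by (simp add: u_def field_simps)
  with qc[OF u, of t "- t"] even show ?thesis by simp
qed (use even in auto)

text \<open>The conditional probability \<open>\<psi> t\<close> is at least \<open>\<psi> T\<close>
  inside the slab and at most \<open>\<psi> T\<close> outside, so conditioning on the slab cannot
  lower the probability of \<open>K\<close>. For negative \<open>T\<close> the interval is empty and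
  the left side is 0.\<close>

lemma gaussian_slab_correlation:
  fixes K :: "('i \<Rightarrow> real) set"
  assumes A: "finite A" and \<sigma>: "0 < \<sigma>" and K: "K \<in> sets (\<Pi>\<^sub>M j\<in>A. borel)"
    and conv: "\<And>x y u. x \<in> K \<Longrightarrow> y \<in> K \<Longrightarrow> 0 < u \<Longrightarrow> u < 1 \<Longrightarrow> (\<lambda>j\<in>A. (1 - u) * x j + u * y j) \<in> K"
    and sym: "\<And>x. x \<in> K \<Longrightarrow> (\<lambda>j\<in>A. - x j) \<in> K"
    and v: "(\<Sum>j\<in>A. (v j)\<^sup>2) = 1"
  shows "emeasure (gauss \<sigma>) {-T..T} * emeasure (\<Pi>\<^sub>M j\<in>A. gauss \<sigma>) K
    \<le> emeasure (\<Pi>\<^sub>M j\<in>A. gauss \<sigma>) {x \<in> K. \<bar>\<Sum>j\<in>A. v j * x j\<bar> \<le> T}"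
proof (cases "0 \<le> T")
  case T: True
  obtain i where i: "i \<in> A" "v i \<noteq> 0"
    using v by (metis (no_types, lifting) power_zero_numeral sum.neutral zero_neq_one)
  define I where "I = A - {i}"
  have I: "finite I" "i \<notin> I" and AI: "A = insert i I" using A i by (auto simp: I_def)
  let ?L = "\<lambda>J. \<Pi>\<^sub>M j\<in>J. (lborel :: real measure)" and ?G = "\<Pi>\<^sub>M j\<in>A. gauss \<sigma>" and ?P = "hyperplane_point i I v"
  interpret g: prob_space "gauss \<sigma>" using \<sigma> by (rule prob_space_gauss)
  have sets_G: "sets ?G = sets (\<Pi>\<^sub>M j\<in>A. borel)" "sets (?L A) = sets (\<Pi>\<^sub>M j\<in>A. borel)"
    by (auto intro!: sets_PiM_cong)
  define C where "C = (1 / sqrt (2 * pi * \<sigma>\<^sup>2)) ^ card I / \<bar>v i\<bar>"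
  define E where "E x = ennreal (C * exp (- defect A v x / (2 * \<sigma>\<^sup>2)))" for x
  \<comment> \<open>\<open>log_concave\<close> quantifies over all functions, including those that
    are not \<open>undefined\<close> off \<open>A\<close>, so membership in \<open>K\<close> is
    tested after \<open>restrict\<close>.\<close>
  define F where "F t y = indicator K (restrict (?P t y) A) * E (?P t y)" for t y
  define \<psi> where "\<psi> t = (\<integral>\<^sup>+y. F t y \<partial>?L I)" for t
  have Km: "(\<lambda>x. indicator K (restrict x A) :: ennreal) \<in> borel_measurable (?L A)"
  proof -
    have "indicator K x = (indicator K (restrict x A) :: ennreal)" if "x \<in> space (?L A)" for x
      using that by (auto simp: space_PiM PiE_restrict)
    moreover have "(indicator K :: _ \<Rightarrow> ennreal) \<in> borel_measurable (?L A)"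
      using K sets_G by simp
    ultimately show ?thesis by (simp cong: measurable_cong)
  qed
  have Em: "E \<in> borel_measurable (?L A)" unfolding E_def defect_def by measurable
  have Pm: "?P t \<in> measurable (?L I) (?L A)" for t
    unfolding AI by (rule measurable_hyperplane_point)
  have Fm: "F t \<in> borel_measurable (?L I)" for t
    unfolding F_def[abs_def] by (intro borel_measurable_times_ennreal measurable_compose[OF Pm Km] measurable_compose[OF Pm Em])
  have lcF: "log_concave F"
    unfolding F_def[abs_def] E_def
    by (rule log_concave_exp_defect) (use A v conv \<sigma> in \<open>auto simp: C_def hyperplane_point_convex_combination\<close>)
  have evenF: "F (- t) (\<lambda>j. if j \<in> I then - x j else x j) = F t x" for t x
  proof -
    have eq: "?P (- t) (\<lambda>j. if j \<in> I then - x j else x j) = (\<lambda>j. if j \<in> A then - ?P t x j else ?P t x j)"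
      unfolding AI using I(2) by (rule hyperplane_point_uminus)
    have "restrict (?P t x) A \<in> K \<longleftrightarrow> restrict (\<lambda>j. if j \<in> A then - ?P t x j else ?P t x j) A \<in> K" (is "?l \<in> K \<longleftrightarrow> ?r \<in> K")
    proof -
      have "(\<lambda>j\<in>A. - ?l j) = ?r" "(\<lambda>j\<in>A. - ?r j) = ?l" by auto
      then show ?thesis using sym[of ?l] sym[of ?r] by metis
    qed
    then show ?thesis unfolding F_def eq E_def defect_uminus by (simp add: indicator_def)
  qed
  have \<psi>: "(\<forall>t t' u. 0 < u \<longrightarrow> u < 1 \<longrightarrow> min (\<psi> t) (\<psi> t') \<le> \<psi> ((1 - u) * t + u * t')) \<and> (\<forall>t. \<psi> (- t) = \<psi> t)"
    unfolding \<psi>_def by (rule log_concave_even_marginal_PiM[OF I(1) lcF evenF Fm])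
  have anti: "\<psi> t \<le> \<psi> s" if "\<bar>s\<bar> \<le> \<bar>t\<bar>" for s t
    by (rule even_quasiconcave_antimono_abs[OF _ _ that]) (use \<psi> in blast)+
  have S: "{x \<in> K. (\<Sum>j\<in>A. v j * x j) \<in> B} \<in> sets ?G" if B: "B \<in> sets borel" for B
  proof -
    have "{x \<in> K. (\<Sum>j\<in>A. v j * x j) \<in> B} = K \<inter> ((\<lambda>x. \<Sum>j\<in>A. v j * x j) -` B \<inter> space (\<Pi>\<^sub>M j\<in>A. borel))"
      using sets.sets_into_space[OF K] by auto
    also have "\<dots> \<in> sets (\<Pi>\<^sub>M j\<in>A. borel)"
      by (intro sets.Int[OF K] measurable_sets[OF _ B]) measurable
    finally show ?thesis using sets_G by simp
  qed
  \<comment> \<open>This identifies \<open>\<psi> t\<close> as the conditional probability of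
    \<open>K\<close> given that the inner product of \<open>v\<close> and \<open>x\<close> is
    \<open>t\<close>.\<close>
  have slice: "emeasure ?G {x \<in> K. (\<Sum>j\<in>A. v j * x j) \<in> B} = (\<integral>\<^sup>+t. indicator B t * \<psi> t \<partial>gauss \<sigma>)"
    if B: "B \<in> sets borel" for B
  proof -
    let ?f = "\<lambda>x. indicator K (restrict x A) * indicator B (\<Sum>j\<in>A. v j * x j) :: ennreal"
    have Bm: "(\<lambda>x. indicator B (\<Sum>j\<in>A. v j * x j) :: ennreal) \<in> borel_measurable (?L A)"
      using B by measurable
    have fm: "?f \<in> borel_measurable (?L A)"
      by (rule borel_measurable_times_ennreal[OF Km Bm])
    have "emeasure ?G {x \<in> K. (\<Sum>j\<in>A. v j * x j) \<in> B} = (\<integral>\<^sup>+x. ?f x \<partial>?G)"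
      unfolding nn_integral_indicator[OF S[OF B], symmetric]
    proof (rule nn_integral_cong)
      fix x assume "x \<in> space ?G"
      then have "restrict x A = x" by (auto simp: space_PiM PiE_restrict)
      then show "indicator {x \<in> K. (\<Sum>j\<in>A. v j * x j) \<in> B} x = ?f x" by (simp add: indicator_def)
    qed
    also have "\<dots> = (\<integral>\<^sup>+t. (\<integral>\<^sup>+y. ?f (?P t y) * E (?P t y) \<partial>?L I) \<partial>gauss \<sigma>)"
      unfolding E_def C_def
      by (rule nn_integral_gauss_hyperplanes[of I i v \<sigma> ?f, folded AI, OF I i(2) \<sigma> fm])
    also have "\<dots> = (\<integral>\<^sup>+t. (\<integral>\<^sup>+y. indicator B t * F t y \<partial>?L I) \<partial>gauss \<sigma>)"
      using hyperplane_point_sum[of I i v, OF I i(2)] unfolding AI[symmetric]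
      by (intro nn_integral_cong) (simp add: F_def mult_ac)
    also have "\<dots> = (\<integral>\<^sup>+t. indicator B t * \<psi> t \<partial>gauss \<sigma>)"
      unfolding \<psi>_def by (intro nn_integral_cong nn_integral_cmult Fm)
    finally show ?thesis .
  qed
  \<comment> \<open>The comparison with \<open>\<psi> T\<close> yields
    \<open>\<psi> T * p \<le> a\<close> and \<open>b \<le> \<psi> T * q\<close>, hence
    \<open>p * b \<le> a * q\<close>. Together with p + q = 1 this is
    \<open>p * (a + b) \<le> a\<close>.\<close>
  define p q a b where "p = emeasure (gauss \<sigma>) {-T..T}" and "q = emeasure (gauss \<sigma>) (- {-T..T})"
    and "a = emeasure ?G {x \<in> K. (\<Sum>j\<in>A. v j * x j) \<in> {-T..T}}"
    and "b = emeasure ?G {x \<in> K. (\<Sum>j\<in>A. v j * x j) \<in> - {-T..T}}"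
  have pq: "p + q = 1"
    unfolding p_def q_def using g.emeasure_space_1
    by (subst plus_emeasure) auto
  have ab: "emeasure ?G K = a + b"
    unfolding a_def b_def
    by (subst plus_emeasure[OF S S]) (auto intro!: arg_cong[where f="emeasure ?G"])
  have "\<psi> T * p = (\<integral>\<^sup>+t. \<psi> T * indicator {-T..T} t \<partial>gauss \<sigma>)"
    unfolding p_def by (rule nn_integral_cmult_indicator[symmetric]) simp
  also have "\<dots> \<le> (\<integral>\<^sup>+t. indicator {-T..T} t * \<psi> t \<partial>gauss \<sigma>)"
    using T by (intro nn_integral_mono) (auto simp: indicator_def intro!: anti)
  also have "\<dots> = a" unfolding a_def by (rule slice[symmetric]) simp
  finally have a: "\<psi> T * p \<le> a" .
  have "b = (\<integral>\<^sup>+t. indicator (- {-T..T}) t * \<psi> t \<partial>gauss \<sigma>)" unfolding b_def by (rule slice) simp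
  also have "\<dots> \<le> (\<integral>\<^sup>+t. \<psi> T * indicator (- {-T..T}) t \<partial>gauss \<sigma>)"
    using T by (intro nn_integral_mono) (auto simp: indicator_def intro!: anti)
  also have "\<dots> = \<psi> T * q"
    unfolding q_def by (rule nn_integral_cmult_indicator) simp
  finally have b: "b \<le> \<psi> T * q" .
  have "p * (a + b) = p * a + p * b" by (simp add: distrib_left)
  also have "p * b \<le> p * (\<psi> T * q)" by (rule mult_left_mono[OF b]) simp
  also have "p * (\<psi> T * q) = (\<psi> T * p) * q" by (simp add: mult_ac)
  also have "\<dots> \<le> a * q" by (rule mult_right_mono[OF a]) simp
  also have "p * a + a * q = (p + q) * a" by (simp add: algebra_simps)
  finally have "p * (a + b) \<le> a" by (simp add: pq add_left_mono)
  moreover have "{x \<in> K. \<bar>\<Sum>j\<in>A. v j * x j\<bar> \<le> T} = {x \<in> K. (\<Sum>j\<in>A. v j * x j) \<in> {-T..T}}"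
    by (auto simp: abs_le_iff)
  ultimately show ?thesis unfolding ab by (simp add: p_def a_def)
qed simp

subsection \<open>Sidak's inequality, frames, and the extreme value threshold\<close>

text \<open>The intersection \<open>?K\<close> of the slabs already inserted is again symmetric and
  convex, so each further slab costs at most one factor.\<close>

lemma sidak_inequality:
  fixes \<phi> :: "'b \<Rightarrow> 'i \<Rightarrow> real"
  assumes W: "finite W" and A: "finite A" and \<sigma>: "0 < \<sigma>"
    and unit: "\<And>\<omega>. \<omega> \<in> W \<Longrightarrow> (\<Sum>j\<in>A. (\<phi> \<omega> j)\<^sup>2) = 1"
  shows "emeasure (gauss \<sigma>) {-T..T} ^ card W
    \<le> emeasure (\<Pi>\<^sub>M j\<in>A. gauss \<sigma>) {x \<in> space (\<Pi>\<^sub>M j\<in>A. borel). \<forall>\<omega>\<in>W. \<bar>\<Sum>j\<in>A. \<phi> \<omega> j * x j\<bar> \<le> T}"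
  using W unit
proof (induction W)
  case empty
  interpret prob_space "\<Pi>\<^sub>M j\<in>A. gauss \<sigma>" by (intro prob_space_PiM prob_space_gauss \<sigma>)
  have "space (\<Pi>\<^sub>M j\<in>A. borel) = space (\<Pi>\<^sub>M j\<in>A. gauss \<sigma>)" by (simp add: space_PiM)
  then show ?case using emeasure_space_1 by simp
next
  case (insert \<omega> W)
  let ?K = "{x \<in> space (\<Pi>\<^sub>M j\<in>A. borel). \<forall>\<omega>\<in>W. \<bar>\<Sum>j\<in>A. \<phi> \<omega> j * x j\<bar> \<le> T}"
  have "emeasure (gauss \<sigma>) {-T..T} ^ card (insert \<omega> W)
      \<le> emeasure (gauss \<sigma>) {-T..T} * emeasure (\<Pi>\<^sub>M j\<in>A. gauss \<sigma>) ?K"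
    using insert by (simp add: mult_left_mono)
  also have "\<dots> \<le> emeasure (\<Pi>\<^sub>M j\<in>A. gauss \<sigma>) {x \<in> ?K. \<bar>\<Sum>j\<in>A. \<phi> \<omega> j * x j\<bar> \<le> T}"
  proof (rule gaussian_slab_correlation[OF A \<sigma>])
    show "?K \<in> sets (\<Pi>\<^sub>M j\<in>A. borel)"
      using insert.hyps(1) by measurable
    show "(\<Sum>j\<in>A. (\<phi> \<omega> j)\<^sup>2) = 1" using insert.prems by simp
    show "(\<lambda>j\<in>A. - x j) \<in> ?K" if "x \<in> ?K" for x
    proof -
      have "(\<Sum>j\<in>A. \<phi> \<omega> j * (\<lambda>j\<in>A. - x j) j) = - (\<Sum>j\<in>A. \<phi> \<omega> j * x j)" for \<omega>
        unfolding sum_negf[symmetric] by (intro sum.cong) auto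
      then show ?thesis using that by (simp add: space_PiM)
    qed
    fix x y :: "'i \<Rightarrow> real" and u :: real
    assume x: "x \<in> ?K" and y: "y \<in> ?K" and u: "0 < u" "u < 1"
    have "\<bar>\<Sum>j\<in>A. \<phi> \<omega> j * (\<lambda>j\<in>A. (1 - u) * x j + u * y j) j\<bar> \<le> T" if "\<omega> \<in> W" for \<omega>
    proof -
      have "(\<Sum>j\<in>A. \<phi> \<omega> j * (\<lambda>j\<in>A. (1 - u) * x j + u * y j) j)
          = (1 - u) * (\<Sum>j\<in>A. \<phi> \<omega> j * x j) + u * (\<Sum>j\<in>A. \<phi> \<omega> j * y j)"
        unfolding sum_distrib_left sum.distrib[symmetric]
        by (intro sum.cong) (auto simp: algebra_simps)
      also have "\<bar>\<dots>\<bar> \<le> (1 - u) * \<bar>\<Sum>j\<in>A. \<phi> \<omega> j * x j\<bar> + u * \<bar>\<Sum>j\<in>A. \<phi> \<omega> j * y j\<bar>"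
        using u by (intro order_trans[OF abs_triangle_ineq]) (simp add: abs_mult)
      also have "\<dots> \<le> (1 - u) * T + u * T"
        using u x y that by (intro add_mono mult_left_mono) auto
      finally show ?thesis by (simp add: algebra_simps)
    qed
    then show "(\<lambda>j\<in>A. (1 - u) * x j + u * y j) \<in> ?K" by (simp add: space_PiM)
  qed
  also have "{x \<in> ?K. \<bar>\<Sum>j\<in>A. \<phi> \<omega> j * x j\<bar> \<le> T}
      = {x \<in> space (\<Pi>\<^sub>M j\<in>A. borel). \<forall>\<omega>\<in>insert \<omega> W. \<bar>\<Sum>j\<in>A. \<phi> \<omega> j * x j\<bar> \<le> T}"
    by auto
  finally show ?case .
qed

section \<open>Dimension count for frames\<close>

lemma underdetermined_system:
  fixes f :: "'b \<Rightarrow> 'i \<Rightarrow> real"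
  assumes "finite W" "finite A" "card W < card A"
  shows "\<exists>u. (\<exists>i\<in>A. u i \<noteq> 0) \<and> (\<forall>\<omega>\<in>W. (\<Sum>i\<in>A. f \<omega> i * u i) = 0)"
  using assms
proof (induction W arbitrary: A f)
  case empty
  then obtain i where "i \<in> A" by (metis card.empty card_gt_0_iff ex_in_conv)
  then show ?case by (intro exI[of _ "\<lambda>_. 1"]) auto
next
  case (insert \<omega> W)
  show ?case
  proof (cases "\<forall>i\<in>A. f \<omega> i = 0")
    case True
    have "card W < card A" using insert by simp
    from insert.IH[OF insert.prems(1) this, of f] True show ?thesis by auto
  next
    case False
    then obtain i where i: "i \<in> A" "f \<omega> i \<noteq> 0" by auto
    let ?B = "A - {i}"
    \<comment> \<open>Gaussian elimination with pivot \<open>f \<omega> i\<close>: each row loses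
      the multiple of row \<omega> that clears column \<open>i\<close>. Below, \<open>w\<close> is
      the back substitution that solves row \<omega> for coordinate \<open>i\<close>.\<close>
    define g where "g \<eta> j = f \<eta> j - f \<eta> i * f \<omega> j / f \<omega> i" for \<eta> j
    have "card W < card ?B" using insert i by simp
    from insert.IH[OF _ this, of g] insert.prems obtain u
      where u: "\<exists>j\<in>?B. u j \<noteq> 0" "\<And>\<eta>. \<eta> \<in> W \<Longrightarrow> (\<Sum>j\<in>?B. g \<eta> j * u j) = 0" by auto
    define w where "w = u(i := - (\<Sum>j\<in>?B. f \<omega> j * u j) / f \<omega> i)"
    have sum_w: "(\<Sum>j\<in>A. f \<eta> j * w j) = (\<Sum>j\<in>?B. g \<eta> j * u j)" for \<eta>
    proof -
      have "(\<Sum>j\<in>A. f \<eta> j * w j) = f \<eta> i * w i + (\<Sum>j\<in>?B. f \<eta> j * w j)"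
        using insert.prems i by (simp add: sum.remove)
      also have "(\<Sum>j\<in>?B. f \<eta> j * w j) = (\<Sum>j\<in>?B. f \<eta> j * u j)"
        by (intro sum.cong) (auto simp: w_def)
      also have "f \<eta> i * w i = - (\<Sum>j\<in>?B. f \<eta> i * f \<omega> j / f \<omega> i * u j)"
        by (simp add: w_def sum_distrib_left sum_divide_distrib mult.assoc)
      finally show ?thesis by (simp add: g_def left_diff_distrib sum_subtractf)
    qed
    have "g \<omega> j = 0" for j using i by (simp add: g_def)
    then have "\<forall>\<eta>\<in>insert \<omega> W. (\<Sum>j\<in>A. f \<eta> j * w j) = 0"
      using u(2) by (simp add: sum_w)
    moreover have "\<exists>j\<in>A. w j \<noteq> 0" using u(1) by (auto simp: w_def)
    ultimately show ?thesis by blast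
  qed
qed

text \<open>With too few elements some nonzero \<open>u\<close> is orthogonal to all of them; being
  also in their span, it would be orthogonal to itself.\<close>

lemma frame_card_ge:
  assumes A: "finite A" and "is_frame A W \<phi>"
  shows "card A \<le> card W"
proof (rule ccontr)
  assume "\<not> ?thesis"
  with assms obtain u where u: "\<exists>i\<in>A. u i \<noteq> 0" "\<And>\<omega>. \<omega> \<in> W \<Longrightarrow> (\<Sum>i\<in>A. \<phi> \<omega> i * u i) = 0"
    using underdetermined_system[of W A \<phi>] by (auto simp: is_frame_def)
  have "restrict u A \<in> vecs A" by (simp add: vecs_def)
  with assms obtain c where "\<forall>i\<in>A. restrict u A i = (\<Sum>\<omega>\<in>W. c \<omega> * \<phi> \<omega> i)"
    unfolding is_frame_def by blast
  then have c: "\<And>i. i \<in> A \<Longrightarrow> u i = (\<Sum>\<omega>\<in>W. c \<omega> * \<phi> \<omega> i)" by simp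
  have "(\<Sum>i\<in>A. u i * u i) = (\<Sum>i\<in>A. \<Sum>\<omega>\<in>W. c \<omega> * (\<phi> \<omega> i * u i))"
    using c by (intro sum.cong refl) (simp add: sum_distrib_right mult.assoc)
  also have "\<dots> = (\<Sum>\<omega>\<in>W. c \<omega> * (\<Sum>i\<in>A. \<phi> \<omega> i * u i))"
    by (subst sum.swap) (simp add: sum_distrib_left)
  also have "\<dots> = 0" using u(2) by simp
  finally have "\<forall>i\<in>A. u i * u i = 0" using A by (subst (asm) sum_nonneg_eq_0_iff) auto
  with u(1) show False by auto
qed

section \<open>Gaussian tail bound\<close>

lemma nn_integral_normal_tail_le:
  assumes \<sigma>: "0 < \<sigma>" and T: "0 < T"
  shows "(\<integral>\<^sup>+t. ennreal (normal_density 0 \<sigma> t) * indicator {T..} t \<partial>lborel)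
    \<le> ennreal (\<sigma>\<^sup>2 / T * normal_density 0 \<sigma> T)"
proof -
  have lim: "((\<lambda>t. - \<sigma>\<^sup>2 / T * (1 / sqrt (2 * pi * \<sigma>\<^sup>2) * exp (- t\<^sup>2 / (2 * \<sigma>\<^sup>2)))) \<longlongrightarrow> 0) at_top"
    using \<sigma> by real_asymp
  \<comment> \<open>The factor \<open>t / T\<close> is at least 1 on the tail and turns the
    integrand into an exact derivative.\<close>
  have "(\<integral>\<^sup>+t. ennreal (normal_density 0 \<sigma> t) * indicator {T..} t \<partial>lborel)
      \<le> (\<integral>\<^sup>+t. ennreal (t / T * normal_density 0 \<sigma> t) * indicator {T..} t \<partial>lborel)"
  proof (intro nn_integral_mono)
    fix t
    have "normal_density 0 \<sigma> t \<le> t / T * normal_density 0 \<sigma> t" if "T \<le> t"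
      using mult_right_mono[of 1 "t / T" "normal_density 0 \<sigma> t"] that T by simp
    then show "ennreal (normal_density 0 \<sigma> t) * indicator {T..} t \<le> ennreal (t / T * normal_density 0 \<sigma> t) * indicator {T..} t"
      by (auto simp: indicator_def intro: ennreal_leI)
  qed
  also have "\<dots> = ennreal (0 - (- \<sigma>\<^sup>2 / T * normal_density 0 \<sigma> T))"
  proof (rule nn_integral_FTC_atLeast[where F = "\<lambda>t. - \<sigma>\<^sup>2 / T * normal_density 0 \<sigma> t"])
    show "((\<lambda>t. - \<sigma>\<^sup>2 / T * normal_density 0 \<sigma> t) \<longlongrightarrow> 0) at_top"
      using lim by (simp add: normal_density_def)
    show "DERIV (\<lambda>t. - \<sigma>\<^sup>2 / T * normal_density 0 \<sigma> t) t :> t / T * normal_density 0 \<sigma> t" for t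
      unfolding normal_density_def using \<sigma> T
      by (auto intro!: derivative_eq_intros simp: field_simps power2_eq_square)
  qed (use T in auto)
  finally show ?thesis by simp
qed

lemma gauss_interval_ge:
  assumes \<sigma>: "0 < \<sigma>" and T: "0 < T"
  shows "1 - 2 * (\<sigma>\<^sup>2 / T * normal_density 0 \<sigma> T) \<le> measure (gauss \<sigma>) {-T..T}"
proof -
  interpret prob_space "gauss \<sigma>" using \<sigma> by (rule prob_space_gauss)
  let ?r = "\<sigma>\<^sup>2 / T * normal_density 0 \<sigma> T"
  have r: "0 \<le> ?r" using T by simp
  have up: "emeasure (gauss \<sigma>) {T..} \<le> ennreal ?r"
    unfolding gauss_def using nn_integral_normal_tail_le[OF assms] by (subst emeasure_density) auto
  have "emeasure (gauss \<sigma>) {..-T} = (\<integral>\<^sup>+t. ennreal (normal_density 0 \<sigma> t) * indicator {..-T} t \<partial>lborel)"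
    unfolding gauss_def by (subst emeasure_density) auto
  also have "\<dots> = (\<integral>\<^sup>+t. ennreal (normal_density 0 \<sigma> (- t)) * indicator {..-T} (- t) \<partial>lborel)"
    by (subst nn_integral_real_affine[where c="-1" and t=0]) auto
  also have "\<dots> = (\<integral>\<^sup>+t. ennreal (normal_density 0 \<sigma> t) * indicator {T..} t \<partial>lborel)"
    by (intro nn_integral_cong) (simp add: normal_density_def indicator_def)
  also have "\<dots> \<le> ennreal ?r" by (rule nn_integral_normal_tail_le[OF assms])
  finally have low: "emeasure (gauss \<sigma>) {..-T} \<le> ennreal ?r" .
  have "1 = prob (space (gauss \<sigma>))" by (simp only: prob_space)
  also have "space (gauss \<sigma>) = {-T..T} \<union> ({T..} \<union> {..-T})" by auto
  also have "prob \<dots> \<le> prob {-T..T} + (prob {T..} + prob {..-T})"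
    by (intro order_trans[OF measure_Un_le] add_left_mono measure_Un_le) auto
  also have "prob {T..} \<le> ?r" using up r by (simp add: emeasure_eq_measure)
  also have "prob {..-T} \<le> ?r" using low r by (simp add: emeasure_eq_measure)
  finally show ?thesis by linarith
qed

section \<open>Asymptotics of the extreme value threshold\<close>

lemma ev_threshold_antimono:
  assumes "0 < \<sigma>" "0 < a" "a \<le> b" "b < 1" "1 \<le> N"
  shows "ev_threshold \<sigma> b N \<le> ev_threshold \<sigma> a N"
proof -
  have "0 < ln (1 / (1 - a))" "ln (1 / (1 - a)) \<le> ln (1 / (1 - b))"
    using assms by (auto simp: field_simps)
  then have "ev_quantile b \<le> ev_quantile a" by (simp add: ev_quantile_def)
  then show ?thesis
    unfolding ev_threshold_def using assms
    by (intro add_left_mono mult_left_mono divide_right_mono) auto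
qed

lemma ev_threshold_scale: "ev_threshold \<sigma> a N = \<sigma> * ev_threshold 1 a N"
  by (simp add: ev_threshold_def distrib_left)

text \<open>The second sequence is \<open>N\<close> times the two-sided tail bound at the threshold
  for \<sigma> = 1. The quantile is chosen so that \<open>exp (- ev_quantile b)\<close> equals log
  (1 / (1 - b)), and all other factors cancel or tend to 1.\<close>

lemma ev_threshold_asymptotics:
  assumes b: "0 < b" "b < 1"
  shows "filterlim (ev_threshold 1 b) at_top sequentially"
    and "(\<lambda>N. real N * (2 / (ev_threshold 1 b N * sqrt (2 * pi)) * exp (- (ev_threshold 1 b N)\<^sup>2 / 2)))
      \<longlonglongrightarrow> - ln (1 - b)"
proof -
  \<comment> \<open>\<open>k\<close> collects the constants, so that with y = log N the threshold is
    sqrt (2 y) + w / sqrt (2 y) for w = k - log y / 2.\<close>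
  define k where "k = ev_quantile b - ln pi / 2"
  define \<tau> where "\<tau> y = sqrt (2 * y) + (2 * k - ln y) / (2 * sqrt (2 * y))" for y
  have \<tau>: "ev_threshold 1 b N = \<tau> (ln (real N))" for N
    by (simp add: ev_threshold_def \<tau>_def k_def)
  have ln_lim: "filterlim (\<lambda>N. ln (real N)) at_top sequentially" by real_asymp
  have \<tau>_lim: "filterlim \<tau> at_top at_top" unfolding \<tau>_def by real_asymp
  show "filterlim (ev_threshold 1 b) at_top sequentially"
    unfolding \<tau>[abs_def] by (rule filterlim_compose[OF \<tau>_lim ln_lim])
  have l1: "((\<lambda>y. sqrt (2 * y) / \<tau> y) \<longlongrightarrow> 1) at_top" unfolding \<tau>_def by real_asymp
  have l2: "((\<lambda>y. exp (- ((2 * k - ln y) / 2)\<^sup>2 / (4 * y))) \<longlongrightarrow> 1) at_top" by real_asymp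
  have c: "exp (- ev_quantile b) = - ln (1 - b)"
    using b by (simp add: ev_quantile_def ln_div)
  \<comment> \<open>Squaring gives y + w + w^2 / (4 y) for half the squared threshold. Then exp (-
    y) cancels N, and exp (- w) supplies the sqrt (pi y) that balances the prefactor of the tail
    bound.\<close>
  have key: "exp y * (2 / (\<tau> y * sqrt (2 * pi)) * exp (- (\<tau> y)\<^sup>2 / 2))
      = exp (- ev_quantile b) * (sqrt (2 * y) / \<tau> y * exp (- ((2 * k - ln y) / 2)\<^sup>2 / (4 * y)))"
    if y: "0 < y" for y
  proof -
    define w where "w = (2 * k - ln y) / 2"
    have s: "sqrt (2 * y) * sqrt (2 * y) = 2 * y" "0 < sqrt (2 * y)" using y by simp_all
    have "\<tau> y = sqrt (2 * y) + w / sqrt (2 * y)" by (simp add: \<tau>_def w_def)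
    then have "(\<tau> y)\<^sup>2 = (sqrt (2 * y))\<^sup>2 + 2 * w + w\<^sup>2 / (sqrt (2 * y))\<^sup>2"
      using s(2) by (simp add: power2_sum power_divide)
    then have "(\<tau> y)\<^sup>2 / 2 = y + w + w\<^sup>2 / (4 * y)"
      using y by (simp add: field_simps)
    then have e1: "exp (- (\<tau> y)\<^sup>2 / 2) = exp (- y) * exp (- w) * exp (- w\<^sup>2 / (4 * y))"
      by (simp add: exp_add[symmetric])
    have e2: "exp (- w) = exp (- ev_quantile b) * (sqrt pi * sqrt y)"
    proof -
      have "- w = - ev_quantile b + (ln (sqrt pi) + ln (sqrt y))"
        using y by (simp add: w_def k_def ln_sqrt field_simps)
      then have "exp (- w) = exp (- ev_quantile b) * (exp (ln (sqrt pi)) * exp (ln (sqrt y)))"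
        by (simp only: exp_add)
      then show ?thesis using y by simp
    qed
    have e3: "2 / (\<tau> y * sqrt (2 * pi)) * (sqrt pi * sqrt y) = sqrt (2 * y) / \<tau> y"
    proof -
      have "2 * (sqrt pi * sqrt y) = sqrt (2 * y) * sqrt (2 * pi)"
        by (simp add: real_sqrt_mult)
      then show ?thesis by (simp add: field_simps)
    qed
    have "exp y * (2 / (\<tau> y * sqrt (2 * pi)) * exp (- (\<tau> y)\<^sup>2 / 2))
      = exp y * exp (- y) * (exp (- ev_quantile b) * (2 / (\<tau> y * sqrt (2 * pi)) * (sqrt pi * sqrt y) * exp (- w\<^sup>2 / (4 * y))))"
      unfolding e1 e2 by (simp only: mult_ac)
    also have "exp y * exp (- y) = 1" by (simp add: exp_add[symmetric])
    finally show ?thesis unfolding e3 w_def by simp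
  qed
  have "((\<lambda>y. exp (- ev_quantile b) * (sqrt (2 * y) / \<tau> y * exp (- ((2 * k - ln y) / 2)\<^sup>2 / (4 * y))))
      \<longlongrightarrow> exp (- ev_quantile b) * (1 * 1)) at_top"
    by (intro tendsto_mult tendsto_const l1 l2)
  then have "((\<lambda>y. exp y * (2 / (\<tau> y * sqrt (2 * pi)) * exp (- (\<tau> y)\<^sup>2 / 2))) \<longlongrightarrow> - ln (1 - b)) at_top"
    by (rule Lim_transform_eventually[THEN tendsto_eq_rhs])
      (use key c in \<open>auto intro!: eventually_mono[OF eventually_gt_at_top[of 0]]\<close>)
  from filterlim_compose[OF this ln_lim]
  have "(\<lambda>N. exp (ln (real N)) * (2 / (\<tau> (ln (real N)) * sqrt (2 * pi)) * exp (- (\<tau> (ln (real N)))\<^sup>2 / 2))) \<longlonglongrightarrow> - ln (1 - b)" .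
  then show "(\<lambda>N. real N * (2 / (ev_threshold 1 b N * sqrt (2 * pi)) * exp (- (ev_threshold 1 b N)\<^sup>2 / 2)))
      \<longlonglongrightarrow> - ln (1 - b)"
    unfolding \<tau>
    by (rule Lim_transform_eventually) (auto intro!: eventually_mono[OF eventually_gt_at_top[of 0]])
qed

lemma eventually_gauss_interval_power_ge:
  assumes \<sigma>: "0 < \<sigma>" and b: "0 < b" "b < b'" "b' < 1"
  shows "eventually (\<lambda>N. 1 - b' \<le> measure (gauss \<sigma>) {- ev_threshold \<sigma> b N..ev_threshold \<sigma> b N} ^ N) sequentially"
proof -
  \<comment> \<open>A level strictly between leaves room for two limits: \<open>b < c\<close>
    absorbs the error of the tail asymptotics, \<open>c < b'\<close> that of (1 + log (1 - c) / N)^N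
    against its limit 1 - c.\<close>
  define c where "c = (b + b') / 2"
  have c: "b < c" "c < b'" using b by (auto simp: c_def)
  let ?\<theta> = "ev_threshold 1 b"
  have ev1: "eventually (\<lambda>N. 0 < ?\<theta> N) sequentially"
    using ev_threshold_asymptotics(1)[of b] b by (auto simp: filterlim_at_top_dense)
  have "- ln (1 - b) < - ln (1 - c)" using b c by simp
  then have ev2: "eventually (\<lambda>N. real N * (2 / (?\<theta> N * sqrt (2 * pi)) * exp (- (?\<theta> N)\<^sup>2 / 2)) < - ln (1 - c)) sequentially"
    using ev_threshold_asymptotics(2)[of b] b by (intro order_tendstoD) auto
  have "(\<lambda>N. (1 + ln (1 - c) / real N) ^ N) \<longlonglongrightarrow> exp (ln (1 - c))"
    by (rule tendsto_exp_limit_sequentially)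
  then have ev3: "eventually (\<lambda>N. 1 - b' < (1 + ln (1 - c) / real N) ^ N) sequentially"
    using b c by (intro order_tendstoD) auto
  \<comment> \<open>The base must be nonnegative before the inequality can be raised to the power
    \<open>N\<close>.\<close>
  have ev4: "eventually (\<lambda>N. 1 + ln (1 - c) / real N > 0) sequentially"
  proof -
    have "(\<lambda>N. 1 + ln (1 - c) / real N) \<longlonglongrightarrow> 1" by real_asymp
    then show ?thesis by (rule order_tendstoD) simp
  qed
  show ?thesis
    using ev1 ev2 ev3 ev4 eventually_gt_at_top[of 0]
  proof eventually_elim
    case (elim N)
    let ?T = "ev_threshold \<sigma> b N"
    have T: "?T = \<sigma> * ?\<theta> N" by (rule ev_threshold_scale)
    have "2 * (\<sigma>\<^sup>2 / ?T * normal_density 0 \<sigma> ?T) = 2 / (?\<theta> N * sqrt (2 * pi)) * exp (- (?\<theta> N)\<^sup>2 / 2)"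
      unfolding T normal_density_def using \<sigma> elim(1)
      by (simp add: real_sqrt_mult power_mult_distrib field_simps power2_eq_square)
    also have "\<dots> \<le> - ln (1 - c) / real N" using elim(2,5) by (simp add: field_simps)
    finally have "1 + ln (1 - c) / real N \<le> 1 - 2 * (\<sigma>\<^sup>2 / ?T * normal_density 0 \<sigma> ?T)" by simp
    also have "\<dots> \<le> measure (gauss \<sigma>) {-?T..?T}"
      by (rule gauss_interval_ge) (use \<sigma> elim T in auto)
    finally have "(1 + ln (1 - c) / real N) ^ N \<le> measure (gauss \<sigma>) {-?T..?T} ^ N"
      using elim(4) by (intro power_mono) auto
    then show ?case using elim(3) by simp
  qed
qed

subsection \<open>Thresholding\<close>

text \<open>A perturbation of size at most \<open>T\<close> enlarges the absolute value by at most
  \<open>T\<close>, and thresholding takes that amount off again.\<close>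

lemma soft_threshold_abs_le:
  fixes s t T :: real
  assumes "\<bar>t\<bar> \<le> T"
  shows "\<bar>sgn (s + t) * max 0 (\<bar>s + t\<bar> - T)\<bar> \<le> \<bar>s\<bar>"
proof -
  have "\<bar>sgn (s + t) * max 0 (\<bar>s + t\<bar> - T)\<bar> \<le> max 0 (\<bar>s + t\<bar> - T)"
    by (simp add: abs_mult abs_sgn_eq)
  also have "\<dots> \<le> \<bar>s\<bar>" using assms by linarith
  finally show ?thesis .
qed

lemma grid_facts:
  assumes "d \<ge> 1" "n \<ge> 1"
  shows "finite (grid d n)" "grid d n \<noteq> {}" "n \<le> card (grid d n)"
proof -
  show "finite (grid d n)" by (simp add: grid_def finite_PiE)
  show "grid d n \<noteq> {}" using assms by (simp add: grid_def PiE_eq_empty_iff lessThan_empty_iff)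
  have "card (grid d n) = n ^ d" by (simp add: grid_def card_PiE)
  then show "n \<le> card (grid d n)" using assms self_le_power[of n d] by simp
qed

section \<open>Transfer of Sidak's inequality to the noise vector\<close>

lemma (in prob_space) distr_gaussian_vector:
  assumes A: "A \<noteq> {}" and X: "X \<in> measurable M (\<Pi>\<^sub>M i\<in>A. borel)"
    and indep: "indep_vars (\<lambda>_. borel) (\<lambda>i w. X w i) A"
    and normal: "\<And>i. i \<in> A \<Longrightarrow> distributed M lborel (\<lambda>w. X w i) (\<lambda>t. ennreal (normal_density 0 \<sigma> t))"
  shows "distr M (\<Pi>\<^sub>M i\<in>A. borel) X = (\<Pi>\<^sub>M i\<in>A. gauss \<sigma>)"
proof -
  have Xi: "random_variable borel (\<lambda>w. X w i)" if "i \<in> A" for i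
    using measurable_compose[OF X measurable_component_singleton[OF that]] .
  have "distr M (\<Pi>\<^sub>M i\<in>A. borel) X = distr M (\<Pi>\<^sub>M i\<in>A. borel) (\<lambda>w. \<lambda>i\<in>A. X w i)"
  proof (intro distr_cong refl)
    fix w assume "w \<in> space M"
    from measurable_space[OF X this] show "X w = (\<lambda>i\<in>A. X w i)"
      by (simp add: space_PiM PiE_restrict)
  qed
  also have "\<dots> = (\<Pi>\<^sub>M i\<in>A. distr M borel (\<lambda>w. X w i))"
    using indep_vars_iff_distr_eq_PiM'[OF A Xi] indep by simp
  also have "\<dots> = (\<Pi>\<^sub>M i\<in>A. gauss \<sigma>)"
  proof (intro PiM_cong refl)
    fix i assume "i \<in> A"
    from distributed_distr_eq_density[OF normal[OF this]]
    show "distr M borel (\<lambda>w. X w i) = gauss \<sigma>"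
      unfolding gauss_def by (simp cong: distr_cong)
  qed
  finally show ?thesis .
qed

lemma (in prob_space) prob_coefficients_bounded_ge:
  fixes T :: real
  assumes A: "finite A" "A \<noteq> {}" and W: "finite W" and \<sigma>: "0 < \<sigma>"
    and X: "X \<in> measurable M (\<Pi>\<^sub>M i\<in>A. borel)"
    and indep: "indep_vars (\<lambda>_. borel) (\<lambda>i w. X w i) A"
    and normal: "\<And>i. i \<in> A \<Longrightarrow> distributed M lborel (\<lambda>w. X w i) (\<lambda>t. ennreal (normal_density 0 \<sigma> t))"
    and \<phi>: "normalized A W \<phi>"
  defines "B \<equiv> {w \<in> space M. \<forall>\<omega>\<in>W. \<bar>inner_on A (\<phi> \<omega>) (X w)\<bar> \<le> T}"
  shows "B \<in> events" "measure (gauss \<sigma>) {-T..T} ^ card W \<le> prob B"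
proof -
  interpret g: prob_space "gauss \<sigma>" using \<sigma> by (rule prob_space_gauss)
  let ?S = "{x \<in> space (\<Pi>\<^sub>M j\<in>A. borel). \<forall>\<omega>\<in>W. \<bar>\<Sum>j\<in>A. \<phi> \<omega> j * x j\<bar> \<le> T}"
  have S: "?S \<in> sets (\<Pi>\<^sub>M j\<in>A. borel)" using W by measurable
  have B: "B = X -` ?S \<inter> space M"
    using measurable_space[OF X] by (auto simp: B_def inner_on_def)
  show "B \<in> events" unfolding B by (rule measurable_sets[OF X S])
  have unit: "(\<Sum>j\<in>A. (\<phi> \<omega> j)\<^sup>2) = 1" if "\<omega> \<in> W" for \<omega>
    using \<phi> that by (auto simp: normalized_def L2_set_def)
  have "emeasure (gauss \<sigma>) {-T..T} ^ card W \<le> emeasure (\<Pi>\<^sub>M j\<in>A. gauss \<sigma>) ?S"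
    by (rule sidak_inequality[OF W A(1) \<sigma> unit])
  also have "\<dots> = emeasure M B"
    using emeasure_distr[OF X S] by (simp only: B distr_gaussian_vector[OF A(2) X indep normal])
  finally show "measure (gauss \<sigma>) {-T..T} ^ card W \<le> prob B"
    by (simp add: emeasure_eq_measure g.emeasure_eq_measure ennreal_power)
qed

lemma inner_prob_ge:
  assumes "prob_space M" "B \<in> sets M" "B \<subseteq> E"
  shows "measure M B \<le> inner_prob M E"
proof -
  interpret prob_space M by fact
  show ?thesis
    unfolding inner_prob_def using assms(2,3) by (intro cSUP_upper bdd_aboveI2[of _ _ 1]) auto
qed

theorem theorem3p8:
  fixes d :: nat and \<sigma> :: real
    and \<Omega> :: "nat \<Rightarrow> 'b set"
    and \<phi> :: "nat \<Rightarrow> 'b \<Rightarrow> (nat \<Rightarrow> nat) \<Rightarrow> real"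
    and J :: "nat \<Rightarrow> ('b \<Rightarrow> real) \<Rightarrow> ereal"
    and M :: "'w measure"
    and \<epsilon> :: "nat \<Rightarrow> 'w \<Rightarrow> (nat \<Rightarrow> nat) \<Rightarrow> real"
    and \<alpha> :: "nat \<Rightarrow> real" and a :: real
  assumes "d \<ge> 1" and "\<sigma> > 0"
    and "\<And>n. n \<ge> 1 \<Longrightarrow> is_frame (grid d n) (\<Omega> n) (\<phi> n)"
    and "\<And>n. n \<ge> 1 \<Longrightarrow> normalized (grid d n) (\<Omega> n) (\<phi> n)"
    and "\<And>n x. n \<ge> 1 \<Longrightarrow> x \<in> vecs (\<Omega> n) \<Longrightarrow> J n x \<noteq> -\<infinity>"
    and "\<And>n x y. n \<ge> 1 \<Longrightarrow> x \<in> vecs (\<Omega> n) \<Longrightarrow> y \<in> vecs (\<Omega> n) \<Longrightarrow>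
           (\<forall>\<omega>\<in>\<Omega> n. \<bar>x \<omega>\<bar> \<le> \<bar>y \<omega>\<bar>) \<Longrightarrow> J n x \<le> J n y"
    and "prob_space M"
    and "\<And>n. n \<ge> 1 \<Longrightarrow> \<epsilon> n \<in> measurable M (\<Pi>\<^sub>M i\<in>grid d n. borel)"
    and "\<And>n. n \<ge> 1 \<Longrightarrow>
           prob_space.indep_vars M (\<lambda>_. borel) (\<lambda>i w. \<epsilon> n w i) (grid d n)"
    and "\<And>n i. n \<ge> 1 \<Longrightarrow> i \<in> grid d n \<Longrightarrow>
           distributed M lborel (\<lambda>w. \<epsilon> n w i) (\<lambda>t. ennreal (normal_density 0 \<sigma> t))"
    and "\<And>n. n \<ge> 1 \<Longrightarrow> 0 < \<alpha> n \<and> \<alpha> n < 1"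
    and "0 \<le> a" and "a < 1" and "\<alpha> \<longlonglongrightarrow> a"
  shows "liminf (\<lambda>n. ereal (inner_prob M
            {w \<in> space M. \<forall>x \<in> analysis_op (grid d n) (\<Omega> n) (\<phi> n) ` vecs (grid d n).
               J n (soft_threshold (\<Omega> n)
                      (\<lambda>\<omega>\<in>\<Omega> n. x \<omega> + analysis_op (grid d n) (\<Omega> n) (\<phi> n) (\<epsilon> n w) \<omega>)
                      (ev_threshold \<sigma> (\<alpha> n) (card (\<Omega> n))))
               \<le> J n x}))
         \<ge> ereal (1 - a)"
proof -
  interpret prob_space M by fact
  let ?A = "grid d" and ?N = "\<lambda>n. card (\<Omega> n)"
  let ?T = "\<lambda>n. ev_threshold \<sigma> (\<alpha> n) (?N n)"
  define E where "E n = {w \<in> space M. \<forall>x \<in> analysis_op (grid d n) (\<Omega> n) (\<phi> n) ` vecs (grid d n).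
               J n (soft_threshold (\<Omega> n)
                      (\<lambda>\<omega>\<in>\<Omega> n. x \<omega> + analysis_op (grid d n) (\<Omega> n) (\<phi> n) (\<epsilon> n w) \<omega>) (?T n)) \<le> J n x}" for n
  have N: "n \<le> ?N n" if n: "1 \<le> n" for n
    using grid_facts[OF assms(1) n] frame_card_ge[OF _ assms(3)[OF n]] by linarith
  then have N_lim: "filterlim ?N at_top sequentially"
    by (intro filterlim_at_top_mono[OF filterlim_ident]) (auto intro!: eventually_sequentiallyI[of 1])
  \<comment> \<open>Any \<open>t\<close> below the actual threshold is allowed, so that a threshold
    of fixed level can be inserted later. The event \<open>?B\<close> constrains the noise alone, so
    this one measurable event serves all signals at once and bounds the inner probability of their
    intersection.\<close>
  have bound: "measure (gauss \<sigma>) {-t..t} ^ ?N n \<le> inner_prob M (E n)" if n: "1 \<le> n" and t: "t \<le> ?T n" for n t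
  proof -
    let ?B = "{w \<in> space M. \<forall>\<omega>\<in>\<Omega> n. \<bar>inner_on (?A n) (\<phi> n \<omega>) (\<epsilon> n w)\<bar> \<le> t}"
    have fin: "finite (\<Omega> n)" using assms(3)[OF n] by (simp add: is_frame_def)
    note B = prob_coefficients_bounded_ge[OF grid_facts(1,2)[OF assms(1) n] fin assms(2) assms(8-10)[OF n]
        assms(4)[OF n], where T = t]
    have "?B \<subseteq> E n"
    proof
      fix w assume w: "w \<in> ?B"
      have "J n (soft_threshold (\<Omega> n) (\<lambda>\<omega>\<in>\<Omega> n. x \<omega> + analysis_op (?A n) (\<Omega> n) (\<phi> n) (\<epsilon> n w) \<omega>) (?T n)) \<le> J n x"
        if "x \<in> analysis_op (?A n) (\<Omega> n) (\<phi> n) ` vecs (?A n)" for x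
      proof (rule assms(6)[OF n])
        show "x \<in> vecs (\<Omega> n)" using that by (auto simp: vecs_def analysis_op_def)
        show "\<forall>\<omega>\<in>\<Omega> n. \<bar>soft_threshold (\<Omega> n) (\<lambda>\<omega>\<in>\<Omega> n. x \<omega> + analysis_op (?A n) (\<Omega> n) (\<phi> n) (\<epsilon> n w) \<omega>) (?T n) \<omega>\<bar> \<le> \<bar>x \<omega>\<bar>"
          using w t by (auto simp: soft_threshold_def analysis_op_def intro!: soft_threshold_abs_le order_trans[OF _ t])
      qed (simp add: vecs_def soft_threshold_def)
      then show "w \<in> E n" using w by (simp add: E_def)
    qed
    from inner_prob_ge[OF assms(7) B(1) this] B(2) show ?thesis by linarith
  qed
  have ev: "eventually (\<lambda>n. 1 - b \<le> inner_prob M (E n)) sequentially" if b: "a < b" "b < 1" for b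
  proof -
    \<comment> \<open>The midpoint exceeds the limit \<open>a\<close>, so eventually
      \<open>\<alpha> n < c\<close> and the threshold of level \<open>c\<close> is the smaller one.
      It is positive even for a = 0, and below \<open>b\<close> as the power bound requires.\<close>
    define c where "c = (a + b) / 2"
    have c: "a < c" "0 < c" "c < b" using b assms by (auto simp: c_def)
    have "eventually (\<lambda>n. \<alpha> n < c) sequentially"
      using assms(14) c(1) by (rule order_tendstoD)
    moreover have "eventually (\<lambda>n. 1 - b \<le> measure (gauss \<sigma>) {- ev_threshold \<sigma> c (?N n)..ev_threshold \<sigma> c (?N n)} ^ ?N n) sequentially"
      using eventually_gauss_interval_power_ge[OF assms(2) c(2,3) b(2)] N_lim
      by (rule eventually_compose_filterlim)
    ultimately show ?thesis
      using eventually_ge_at_top[of 1]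
    proof eventually_elim
      case (elim n)
      have "ev_threshold \<sigma> c (?N n) \<le> ?T n"
        using elim c b assms(2) assms(11)[OF elim(3)] N[OF elim(3)] by (intro ev_threshold_antimono) auto
      from bound[OF elim(3) this] elim(2) show ?case by linarith
    qed
  qed
  have "ereal (1 - a) \<le> liminf (\<lambda>n. ereal (inner_prob M (E n)))"
    unfolding le_Liminf_iff
  proof (intro allI impI)
    fix y assume "y < ereal (1 - a)"
    then obtain r where r: "y < ereal r" "r < 1 - a" using ereal_dense2 by (metis ereal_less(1) less_ereal.simps(1))
    \<comment> \<open>\<open>r\<close> may be negative, whereas the level \<open>1 - s\<close> has
      to be below 1; the maximum with a positive number under 1 - a ensures this.\<close>
    define s where "s = max r ((1 - a) / 2)"
    have s: "r \<le> s" "0 < s" "s < 1 - a" using r \<open>a < 1\<close> by (auto simp: s_def less_max_iff_disj)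
    have "eventually (\<lambda>n. 1 - (1 - s) \<le> inner_prob M (E n)) sequentially"
      by (rule ev) (use s in auto)
    then show "eventually (\<lambda>n. y < ereal (inner_prob M (E n))) sequentially"
    proof (rule eventually_mono)
      fix n assume "1 - (1 - s) \<le> inner_prob M (E n)"
      then have "ereal r \<le> ereal (inner_prob M (E n))" using s by simp
      with r(1) show "y < ereal (inner_prob M (E n))" by (rule less_le_trans)
    qed
  qed
  then show ?thesis unfolding E_def .
qed

end
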